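(* Let $G=(V,E)$ be a finite connected graph with $|V|\ge 2$, and $M$ a positive transition matrix on $G$. For $1\le n\le|V|$ let $S_n$ be the set of rooted edge-labelled trees and $K_n$ the "add a random step and erase the oldest edge" kernel, both described in the context. (i) For $((T_0,R_0),L_0)\in S_n$, the labels $L_1$ produced by a step of $K_n$ are distinct and decreasing on each path toward the root, so that $K_n$ indeed defines a transition matrix on $S_n$. (ii) Let $2\le n\le |V|$. If $(X^{(n)}_j,j\ge0)$ is a Markov chain on $S_n$ with kernel $K_n$, and $X^{(n-1)}_j$ denotes the labelled tree obtained by removing the edge with largest label in $X^{(n)}_j$ (together with the corresponding leaf), then the process $(X^{(n-1)}_j,j\ge0)$ is a Markov chain on $S_{n-1}$ with kernel $K_{n-1}$.
   Context: A transition matrix $M=(M_{a,b})_{a,b\in V}$ is positive on $G$ if $M_{a,b}>0\Leftrightarrow\{a,b\}\in E$. Let $\rho$ be its unique invariant distribution and $\overleftarrow M_{x,y}=\rho_yM_{y,x}/\rho_x$ the time-reversed transition matrix. $S_n=\bigcup_{r\in V}S_{n,r}$, where $S_{n,r}$ is the set of pairs $((t,r),\ell)$ with $t$ a subtree of $G$ with $n$ vertices containing $r$, rooted at $r$ (edges oriented toward $r$), and $\ell$ a labelling of its $n-1$ edges by distinct labels forming the set $\{1,\dots,n-1\}$ that is decreasing along any injective path from a leaf to the root $r$ (the root is not considered as a leaf). Kernel $K_n$: from $((T_0,R_0),L_0)\in S_n$, define $((T_1,R_1),L_1)$ as follows. First choose $R_1$ with $\mathbb P(R_1=v\mid R_0=u)=\overleftarrow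 M_{u,v}$; $R_1$ is the root of $T_1$. Put $e=(R_0,R_1)$. (a) If $R_1=R_0$ (only possible if there is a loop), set $((T_1,R_1),L_1)=((T_0,R_0),L_0)$. (b) If $R_1\ne R_0$ is a vertex of $T_0$, adding $e$ to $T_0$ creates a cycle (possibly the cycle $R_0\to R_1\to R_0$ made of $e$ and an edge of $T_0$ with the same endpoints). Label $e$ temporarily $0$, let $\mathbf m$ be the maximal label on the cycle, remove the edge with label $\mathbf m$, and orient the edges toward the new root $R_1$. (c) If $R_1$ is not a vertex of $T_0$, add $e$ (and the vertex $R_1$) to $T_0$, label $e$ temporarily $0$, and remove the edge of maximal label $\mathbf m=n-1$ together with the leaf to which it is adjacent. In cases (b) and (c), $L_1$ is obtained by keeping the labels $>\mathbf m$ and adding $1$ to all the other labels (those in $\{0,\dots,\mathbf m-1\}$, including that of $e$). For $n=1$, elements of $S_1$ are single vertices and $K_1$ is the transition matrix $\overleftarrow M$ of the root. *)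

theory Defs
  imports "HOL-Probability.Probability"
begin

text \<open>An edge is the set of its endpoints, so a loop at \<open>v\<close> is the singleton \<open>{v}\<close>.\<close>

definition finite_graph :: "'a set \<Rightarrow> 'a set set \<Rightarrow> bool" where
  "finite_graph V E \<longleftrightarrow> finite V \<and> (\<forall>e\<in>E. \<exists>u\<in>V. \<exists>v\<in>V. e = {u, v})"

definition connected_graph :: "'a set \<Rightarrow> 'a set set \<Rightarrow> bool" where
  "connected_graph V E \<longleftrightarrow> (\<forall>u\<in>V. \<forall>v\<in>V. (u, v) \<in> {(x, y). {x, y} \<in> E}\<^sup>*)"

text \<open>Cycles are defined for multigraphs: \<open>D\<close> is a set of edges and \<open>ends d\<close> the set of
  endpoints of \<open>d\<close>. A loop is a cycle of length 1, and two distinct parallel edges form a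
  cycle of length 2.\<close>

definition cycle :: "('e \<Rightarrow> 'a set) \<Rightarrow> 'e set \<Rightarrow> 'a list \<Rightarrow> 'e list \<Rightarrow> bool" where
  "cycle ends D vs es \<longleftrightarrow>
     vs \<noteq> [] \<and> length es = length vs \<and> distinct vs \<and> distinct es \<and> set es \<subseteq> D \<and>
     (\<forall>i<length vs. ends (es ! i) = {vs ! i, vs ! (Suc i mod length vs)})"

definition subtree :: "'a set \<Rightarrow> 'a set set \<Rightarrow> 'a set \<Rightarrow> 'a set set \<Rightarrow> bool" where
  "subtree V E W F \<longleftrightarrow>
     W \<subseteq> V \<and> F \<subseteq> E \<and> (\<forall>f\<in>F. f \<subseteq> W) \<and>
     connected_graph W F \<and> \<not> (\<exists>vs es. cycle (\<lambda>f. f) F vs es)"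

definition inj_path :: "'a set \<Rightarrow> 'a set set \<Rightarrow> 'a list \<Rightarrow> bool" where
  "inj_path W F p \<longleftrightarrow>
     p \<noteq> [] \<and> distinct p \<and> set p \<subseteq> W \<and> successively (\<lambda>x y. {x, y} \<in> F) p"

definition leaf :: "'a set set \<Rightarrow> 'a \<Rightarrow> 'a \<Rightarrow> bool" where
  "leaf F r v \<longleftrightarrow> v \<noteq> r \<and> card {f \<in> F. v \<in> f} = 1"

definition decreasing_along :: "('a set \<Rightarrow> nat) \<Rightarrow> 'a list \<Rightarrow> bool" where
  "decreasing_along L p \<longleftrightarrow> sorted_wrt (>) (map L (map2 (\<lambda>x y. {x, y}) p (tl p)))"

text \<open>A state \<open>(((W, F), r), L)\<close> is a tree with vertex set \<open>W\<close> and edge set \<open>F\<close>, a root \<open>r\<close>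
  and a labelling \<open>L\<close> of \<open>F\<close>. The orientation of the edges toward \<open>r\<close> is a function of
  \<open>((W, F), r)\<close> and is not stored. The labelling is extensional, so that equal
  labelled trees are equal states.\<close>

type_synonym 'a ltree = "(('a set \<times> 'a set set) \<times> 'a) \<times> ('a set \<Rightarrow> nat)"

definition labelled_trees_at :: "'a set \<Rightarrow> 'a set set \<Rightarrow> nat \<Rightarrow> 'a \<Rightarrow> 'a ltree set" where
  "labelled_trees_at V E n r =
     {(((W, F), r), L) | W F L.
        subtree V E W F \<and> card W = n \<and> r \<in> W \<and>
        L \<in> extensional F \<and> bij_betw L F {1..n - 1} \<and>
        (\<forall>p. inj_path W F p \<and> leaf F r (hd p) \<and> last p = r \<longrightarrow> decreasing_along L p)}"

definition labelled_trees :: "'a set \<Rightarrow> 'a set set \<Rightarrow> nat \<Rightarrow> 'a ltree set" where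
  "labelled_trees V E n = (\<Union>r\<in>V. labelled_trees_at V E n r)"

fun root_of :: "'a ltree \<Rightarrow> 'a" where
  "root_of ((t, r), L) = r"

fun remove_max :: "'a ltree \<Rightarrow> 'a ltree" where
  "remove_max (((W, F), r), L) =
     (let f = (THE f. f \<in> F \<and> L f = Max (L ` F));
          v = (THE v. leaf F r v \<and> v \<in> f)
      in (((W - {v}, F - {f}), r), restrict L (F - {f})))"

definition relabel :: "nat \<Rightarrow> nat \<Rightarrow> nat" where
  "relabel m i = (if m < i then i else i + 1)"

text \<open>If the new root \<open>R1\<close> is already a vertex of the tree, the tree together with
  \<open>e = {R0, R1}\<close> is a multigraph, since \<open>{R0, R1}\<close> may already be an edge. Its edges are
  represented by pairs (endpoints, label), the pair \<open>({R0, R1}, 0)\<close> being \<open>e\<close>.\<close>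

definition close_cycle :: "'a ltree \<Rightarrow> 'a \<Rightarrow> 'a ltree" where
  "close_cycle = (\<lambda>(((W, F), R0), L) R1.
     let D = insert ({R0, R1}, 0) ((\<lambda>f. (f, L f)) ` F);
         C = (THE C. \<exists>vs es. cycle fst D vs es \<and> C = set es);
         m = Max (snd ` C);
         D1 = {d \<in> D. snd d \<noteq> m};
         F1 = fst ` D1
     in (((W, F1), R1), (\<lambda>f\<in>F1. relabel m (THE i. (f, i) \<in> D1))))"

text \<open>If \<open>R1\<close> is not a vertex of the tree, the leaf to be removed is understood in the
  enlarged tree rooted at \<open>R1\<close>. Hence a single vertex \<open>R0\<close> is replaced by the single
  vertex \<open>R1\<close>: there \<open>e\<close> itself is the edge of maximal label and \<open>R0\<close> the leaf.\<close>

definition extend_erase :: "'a ltree \<Rightarrow> 'a \<Rightarrow> 'a ltree" where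
  "extend_erase = (\<lambda>(((W, F), R0), L) R1.
     let W' = insert R1 W;
         F' = insert {R0, R1} F;
         L' = L({R0, R1} := 0);
         m = Max (L' ` F');
         ((t1, R), L'') = remove_max (((W', F'), R1), L')
     in ((t1, R), (\<lambda>f\<in>snd t1. relabel m (L'' f))))"

definition step :: "'a ltree \<Rightarrow> 'a \<Rightarrow> 'a ltree" where
  "step = (\<lambda>(((W, F), R0), L) R1.
     if R1 = R0 then (((W, F), R0), L)
     else if R1 \<in> W then close_cycle (((W, F), R0), L) R1
     else extend_erase (((W, F), R0), L) R1)"

definition transition_matrix :: "'s set \<Rightarrow> ('s \<Rightarrow> 's \<Rightarrow> real) \<Rightarrow> bool" where
  "transition_matrix S K \<longleftrightarrow>
     (\<forall>x\<in>S. \<forall>y\<in>S. 0 \<le> K x y) \<and> (\<forall>x\<in>S. (\<Sum>y\<in>S. K x y) = 1)"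

definition positive_on :: "'a set \<Rightarrow> 'a set set \<Rightarrow> ('a \<Rightarrow> 'a \<Rightarrow> real) \<Rightarrow> bool" where
  "positive_on V E M \<longleftrightarrow> (\<forall>a\<in>V. \<forall>b\<in>V. M a b > 0 \<longleftrightarrow> {a, b} \<in> E)"

text \<open>Distributions on \<open>V\<close> are extended by 0 outside \<open>V\<close>, which makes the invariant
  distribution unique as a function on the whole type.\<close>

definition invariant_distribution :: "'a set \<Rightarrow> ('a \<Rightarrow> 'a \<Rightarrow> real) \<Rightarrow> ('a \<Rightarrow> real) \<Rightarrow> bool" where
  "invariant_distribution V M \<rho> \<longleftrightarrow>
     (\<forall>x\<in>V. 0 \<le> \<rho> x) \<and> (\<forall>x. x \<notin> V \<longrightarrow> \<rho> x = 0) \<and> (\<Sum>x\<in>V. \<rho> x) = 1 \<and>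
     (\<forall>y\<in>V. (\<Sum>x\<in>V. \<rho> x * M x y) = \<rho> y)"

definition stationary :: "'a set \<Rightarrow> ('a \<Rightarrow> 'a \<Rightarrow> real) \<Rightarrow> 'a \<Rightarrow> real" where
  "stationary V M = (THE \<rho>. invariant_distribution V M \<rho>)"

definition time_reversal :: "'a set \<Rightarrow> ('a \<Rightarrow> 'a \<Rightarrow> real) \<Rightarrow> 'a \<Rightarrow> 'a \<Rightarrow> real" where
  "time_reversal V M x y = stationary V M y * M y x / stationary V M x"

text \<open>The same formula serves for every number \<open>n\<close> of vertices: the kernel on trees with \<open>n\<close>
  vertices is the restriction to \<open>labelled_trees V E n\<close>.\<close>

definition tree_kernel :: "'a set \<Rightarrow> ('a \<Rightarrow> 'a \<Rightarrow> real) \<Rightarrow> 'a ltree \<Rightarrow> 'a ltree \<Rightarrow> real" where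
  "tree_kernel V M x y = (\<Sum>v\<in>{v \<in> V. step x v = y}. time_reversal V M (root_of x) v)"

text \<open>Markov property with respect to the whole past, for an arbitrary initial law. It is
  meant for a countable state space \<open>S\<close>, where the elementary conditional probabilities
  determine everything.\<close>

definition markov_chain ::
    "'w measure \<Rightarrow> 's set \<Rightarrow> ('s \<Rightarrow> 's \<Rightarrow> real) \<Rightarrow> (nat \<Rightarrow> 'w \<Rightarrow> 's) \<Rightarrow> bool" where
  "markov_chain P S K X \<longleftrightarrow>
     prob_space P \<and> (\<forall>j. X j \<in> measurable P (count_space S)) \<and>
     (\<forall>j x. (\<forall>i\<le>Suc j. x i \<in> S) \<longrightarrow>
        \<P>(\<omega> in P. \<forall>i\<le>j. X i \<omega> = x i) > 0 \<longrightarrow>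
        \<P>(\<omega> in P. X (Suc j) \<omega> = x (Suc j) \<bar> \<forall>i\<le>j. X i \<omega> = x i) = K (x j) (x (Suc j)))"

end

theory Submission imports Defs begin

text \<open>
  The edges of a tree in \<open>S\<^sub>n\<close> can be read in the order of their labels. Since labels decrease
  toward the root, the edge with label \<open>i\<close> joins a new vertex to the part of the tree spanned
  by the root and the edges labelled \<open>1, \<dots>, i - 1\<close>. So an element of \<open>S\<^sub>n\<close> is the same thing as
  a history: a root, followed by \<open>n - 1\<close> vertices, each attached to an earlier one
  (\<open>labelled_trees_eq\<close>). In this description all the operations become operations on lists.

  Removing the edge of largest label forgets the vertex that was attached last. A step from
  the root \<open>r\<close> to a vertex \<open>v \<noteq> r\<close> moves \<open>v\<close> to the front of the order, with \<open>r\<close> as the first vertex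
  attached to it; if \<open>v\<close> was not in the tree, the last vertex is dropped to keep the size
  (\<open>step_tree_of\<close>). The only point that needs an argument is that this agrees with breaking the
  cycle at its maximal label. The cycle consists of the new edge, with label 0, and the path
  from \<open>v\<close> to \<open>r\<close>, along which labels decrease; so the maximum is on the edge that attached
  \<open>v\<close>, which is the one that a move to the front discards. Part (i) follows, because the
  result is again a history and every history is a decreasing labelled tree.

  Truncating a list commutes with moving a given element to the front
  (\<open>tl_move_to_front\<close>), and truncation keeps the root, hence the law of the next root. So
  the law of the truncated tree after one step depends on the current tree only through its
  truncation, and is the one given by the kernel on smaller trees (\<open>tree_kernel_lumps\<close>). A
  function of a Markov chain with this property is a Markov chain (\<open>lumped_markov_chain\<close>),
  which is part (ii).

  That the next root has a probability law at all, carried by the neighbours of the current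
  root, rests on the existence, uniqueness and positivity of the invariant distribution
  (\<open>time_reversal_transition\<close>).
\<close>

section \<open>Paths and cycles\<close>

definition path_edges :: "'a list \<Rightarrow> 'a set list" where
  "path_edges p = map2 (\<lambda>x y. {x, y}) p (tl p)"

lemma path_edges_simps [simp]:
  "path_edges [] = []"
  "path_edges [x] = []"
  "path_edges (x # y # p) = {x, y} # path_edges (y # p)"
  by (simp_all add: path_edges_def)

lemma length_path_edges [simp]: "length (path_edges p) = length p - 1"
  by (simp add: path_edges_def)

lemma decreasing_along_path_edges:
  "decreasing_along L p \<longleftrightarrow> sorted_wrt (>) (map L (path_edges p))"
  by (simp add: decreasing_along_def path_edges_def)

lemma path_edges_subset: "f \<in> set (path_edges p) \<Longrightarrow> f \<subseteq> set p"
proof (induction p)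
  case (Cons x p)
  then show ?case by (cases p) auto
qed simp

lemma path_edges_in_graph:
  assumes "successively (\<lambda>x y. {x, y} \<in> F) p"
  shows "set (path_edges p) \<subseteq> F"
  using assms
proof (induction p)
  case (Cons x p)
  then show ?case by (cases p) auto
qed simp

lemma distinct_path_edges: "distinct p \<Longrightarrow> distinct (path_edges p)"
proof (induction p)
  case (Cons x p)
  show ?case
  proof (cases p)
    case (Cons y q)
    have "{x, y} \<notin> set (path_edges p)"
    proof
      assume "{x, y} \<in> set (path_edges p)"
      then have "x \<in> set p" using path_edges_subset by blast
      then show False using Cons.prems by simp
    qed
    moreover have "path_edges (x # p) = {x, y} # path_edges p" using Cons by simp
    moreover have "distinct (path_edges p)" using Cons.IH Cons.prems by simp
    ultimately show ?thesis by simp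
  qed simp
qed simp

lemma edge_in_path_edges: "{w, u} \<in> set (path_edges (q @ w # u # p))"
proof (induction q)
  case (Cons x q)
  then show ?case by (cases q) auto
qed simp

lemma decreasing_along_short: "length p \<le> 1 \<Longrightarrow> decreasing_along L p"
  by (cases p) (auto simp: decreasing_along_path_edges)

lemma decreasing_along_Cons:
  "decreasing_along L (x # y # p) \<longleftrightarrow>
     (\<forall>f\<in>set (path_edges (y # p)). L f < L {x, y}) \<and> decreasing_along L (y # p)"
  by (simp add: decreasing_along_path_edges)

lemma decreasing_along_suffix: "decreasing_along L (q @ p) \<Longrightarrow> decreasing_along L p"
proof (induction q)
  case (Cons x q)
  have "decreasing_along L (q @ p)"
  proof (cases "q @ p")
    case Nil
    then show ?thesis by (simp add: decreasing_along_path_edges)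
  next
    case (Cons y z)
    then show ?thesis using Cons.prems decreasing_along_Cons[of L x y z] by simp
  qed
  then show ?case by (rule Cons.IH)
qed simp

lemma decreasing_along_cong:
  assumes "\<And>f. f \<in> set (path_edges p) \<Longrightarrow> L f = L' f"
  shows "decreasing_along L p \<longleftrightarrow> decreasing_along L' p"
proof -
  have "map L (path_edges p) = map L' (path_edges p)"
    using assms by (intro map_cong) auto
  then show ?thesis by (simp only: decreasing_along_path_edges)
qed

lemma inj_path_suffix: "inj_path W F (q @ p) \<Longrightarrow> p \<noteq> [] \<Longrightarrow> inj_path W F p"
  by (auto simp: inj_path_def successively_append_iff)

lemma inj_path_prefix: "inj_path W F (q @ p) \<Longrightarrow> q \<noteq> [] \<Longrightarrow> inj_path W F q"
  by (auto simp: inj_path_def successively_append_iff)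

lemma inj_path_Cons_iff:
  "inj_path W F (x # p) \<longleftrightarrow>
     x \<in> W \<and> x \<notin> set p \<and> (p = [] \<or> inj_path W F p \<and> {x, hd p} \<in> F)"
  by (cases p) (auto simp: inj_path_def)

lemma inj_path_edges: "inj_path W F p \<Longrightarrow> set (path_edges p) \<subseteq> F"
  by (rule path_edges_in_graph) (simp add: inj_path_def)

lemma inj_path_mono:
  assumes "inj_path W F p" "W \<subseteq> W'" "F \<subseteq> F'"
  shows "inj_path W' F' p"
  using assms successively_mono[of "\<lambda>x y. {x, y} \<in> F" p "\<lambda>x y. {x, y} \<in> F'"]
  unfolding inj_path_def by blast

lemma inj_path_last_ne:
  assumes "inj_path W F (x # p)" "p \<noteq> []"
  shows "last (x # p) \<noteq> x"
  using assms last_in_set[of p] unfolding inj_path_def by auto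

lemma walk_imp_inj_path:
  assumes "(a, b) \<in> {(x, y). {x, y} \<in> F}\<^sup>*" and "b \<in> W" and F: "\<And>f. f \<in> F \<Longrightarrow> f \<subseteq> W"
  shows "\<exists>p. inj_path W F p \<and> hd p = a \<and> last p = b"
  using assms(1)
proof (induction rule: converse_rtrancl_induct)
  case base
  show ?case using assms(2) by (intro exI[of _ "[b]"]) (simp add: inj_path_def)
next
  case (step a a')
  then obtain p where p: "inj_path W F p" "hd p = a'" "last p = b" by blast
  have e: "{a, a'} \<in> F" using step by simp
  show ?case
  proof (cases "a \<in> set p")
    case True
    then obtain q s where q: "p = q @ a # s" by (auto simp: in_set_conv_decomp)
    have "inj_path W F (a # s)" using inj_path_suffix p(1) q by blast
    then show ?thesis using p(3) q by (intro exI[of _ "a # s"]) auto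
  next
    case False
    have "p \<noteq> []" using p(1) by (simp add: inj_path_def)
    moreover have "a \<in> W" using F[OF e] by simp
    ultimately show ?thesis using False p e
      by (intro exI[of _ "a # p"]) (simp add: inj_path_Cons_iff)
  qed
qed

text \<open>The list \<open>ds\<close> lifts the edges of the path to a multigraph, so that the closing edge \<open>d\<close>
  may be parallel to an edge of the path.\<close>

lemma cycle_from_path:
  assumes "distinct p" "p \<noteq> []" "map ends ds = path_edges p"
    and "distinct ds" "d \<notin> set ds" "insert d (set ds) \<subseteq> D" "ends d = {last p, hd p}"
  shows "cycle ends D p (ds @ [d])"
proof -
  have len: "length ds = length p - 1"
    using arg_cong[OF assms(3), of length] by simp
  have pos: "0 < length p" using assms(2) by simp
  have "ends ((ds @ [d]) ! i) = {p ! i, p ! (Suc i mod length p)}" if i: "i < length p" for i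
  proof (cases "i < length ds")
    case True
    have "ends (ds ! i) = path_edges p ! i"
      using True by (simp flip: assms(3))
    also have "\<dots> = {p ! i, tl p ! i}"
      using True len by (simp add: path_edges_def)
    also have "\<dots> = {p ! i, p ! (Suc i mod length p)}"
      using True len by (simp add: nth_tl)
    finally show ?thesis using True by (simp add: nth_append)
  next
    case False
    then have "i = length p - 1" using i len by linarith
    then show ?thesis using assms(2,7) len pos
      by (simp add: nth_append last_conv_nth hd_conv_nth)
  qed
  then show ?thesis using assms len pos unfolding cycle_def by auto
qed

lemma cycle_mono: "cycle ends D vs es \<Longrightarrow> D \<subseteq> D' \<Longrightarrow> cycle ends D' vs es"
  by (auto simp: cycle_def)

text \<open>Every position of the cycle contributes an edge leaving its vertex and an edge entering the
  next one, so a vertex meets as many leaving as entering edges, and without loops these are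
  different. This parity is all that the proofs need, besides nonemptiness, to see that trees have no
  cycle and that a tree with one additional edge has at most one: it passes to symmetric
  differences, while the edges of a forest contain no nonempty set with even degrees.\<close>

lemma even_degree_of_cycle:
  assumes c: "cycle ends D vs es" and loopfree: "\<And>d. d \<in> D \<Longrightarrow> card (ends d) = 2"
  shows "even (card {d \<in> set es. v \<in> ends d})"
proof -
  define n where "n = length vs"
  have n: "n > 0" "length es = n" "distinct es" "set es \<subseteq> D"
    and ends: "\<forall>i<n. ends (es ! i) = {vs ! i, vs ! (Suc i mod n)}"
    using c unfolding cycle_def n_def by simp_all
  let ?I = "{i. i < n \<and> vs ! i = v}" and ?J = "{i. i < n \<and> vs ! (Suc i mod n) = v}"
  have "{d \<in> set es. v \<in> ends d} = (!) es ` (?I \<union> ?J)"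
  proof (intro set_eqI iffI)
    fix d assume "d \<in> {d \<in> set es. v \<in> ends d}"
    then obtain i where i: "i < n" "d = es ! i" "v \<in> ends (es ! i)"
      using n(2) by (auto simp: in_set_conv_nth)
    have "v \<in> {vs ! i, vs ! (Suc i mod n)}" using i ends by metis
    then have "i \<in> ?I \<union> ?J" using i(1) by auto
    then show "d \<in> (!) es ` (?I \<union> ?J)" using i(2) by (rule rev_image_eqI)
  next
    fix d assume "d \<in> (!) es ` (?I \<union> ?J)"
    then obtain i where i: "i < n" "d = es ! i" "vs ! i = v \<or> vs ! (Suc i mod n) = v" by blast
    have "v \<in> ends d" using i ends by auto
    then show "d \<in> {d \<in> set es. v \<in> ends d}" using i n(2) by simp
  qed
  moreover have "inj_on ((!) es) (?I \<union> ?J)"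
    using n(2,3) by (intro inj_on_nth) auto
  ultimately have "card {d \<in> set es. v \<in> ends d} = card (?I \<union> ?J)"
    by (simp add: card_image)
  also have "?I \<inter> ?J = {}"
  proof (rule ccontr)
    assume "?I \<inter> ?J \<noteq> {}"
    then obtain i where i: "i < n" "ends (es ! i) = {v}" using ends by force
    then have "es ! i \<in> D" using n by auto
    then show False using loopfree[of "es ! i"] i by simp
  qed
  then have "card (?I \<union> ?J) = card ?I + card ?J"
    by (subst card_Un_disjoint) auto
  also have "card ?J = card ?I"
  proof -
    have "bij_betw (\<lambda>i. Suc i mod n) {..<n} {..<n}"
    proof (rule bij_betw_byWitness[where f' = "\<lambda>i. (i + n - 1) mod n"])
      show "\<forall>i\<in>{..<n}. (Suc i mod n + n - 1) mod n = i"
      proof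
        fix i assume "i \<in> {..<n}"
        then consider "Suc i < n" | "Suc i = n" by fastforce
        then show "(Suc i mod n + n - 1) mod n = i" by cases auto
      qed
      show "\<forall>i\<in>{..<n}. Suc ((i + n - 1) mod n) mod n = i"
      proof
        fix i assume i: "i \<in> {..<n}"
        have "Suc ((i + n - 1) mod n) mod n = (i + n) mod n"
          using n by (simp add: mod_Suc_eq)
        then show "Suc ((i + n - 1) mod n) mod n = i" using i by simp
      qed
    qed (use n in auto)
    then have b: "inj_on (\<lambda>i. Suc i mod n) {..<n}" "(\<lambda>i. Suc i mod n) ` {..<n} = {..<n}"
      by (auto simp: bij_betw_def)
    have "?I = (\<lambda>i. Suc i mod n) ` ?J"
    proof (intro set_eqI iffI)
      fix i assume i: "i \<in> ?I"
      then have "i \<in> (\<lambda>i. Suc i mod n) ` {..<n}" using b by simp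
      then show "i \<in> (\<lambda>i. Suc i mod n) ` ?J" using i by auto
    qed (use n in auto)
    moreover have "inj_on (\<lambda>i. Suc i mod n) ?J" using b(1) by (rule inj_on_subset) auto
    ultimately show ?thesis by (simp add: card_image)
  qed
  finally show ?thesis by simp
qed

section \<open>Histories of growth\<close>

text \<open>A pair \<open>(w, u)\<close> in a history \<open>ps\<close> means that the new vertex \<open>w\<close> was attached to \<open>u\<close>. The
  most recent pair is at the head of the list, so that forgetting it is \<^term>\<open>tl ps\<close> and induction
  over lists prunes one leaf at a time. The label of an edge is its position counted from the
  end of the list.\<close>

definition verts :: "'a \<Rightarrow> ('a \<times> 'a) list \<Rightarrow> 'a set" where
  "verts r ps = insert r (fst ` set ps)"

definition edges :: "('a \<times> 'a) list \<Rightarrow> 'a set set" where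
  "edges ps = (\<lambda>(w, u). {w, u}) ` set ps"

lemma verts_simps [simp]:
  "verts r [] = {r}"
  "verts r ((w, u) # ps) = insert w (verts r ps)"
  by (auto simp: verts_def)

lemma edges_simps [simp]:
  "edges [] = {}"
  "edges ((w, u) # ps) = insert {w, u} (edges ps)"
  "edges (ps @ qs) = edges ps \<union> edges qs"
  by (auto simp: edges_def)

lemma finite_edges [simp]: "finite (edges ps)"
  by (simp add: edges_def)

lemma pair_in_edges: "(w, u) \<in> set ps \<Longrightarrow> {w, u} \<in> edges ps"
  unfolding edges_def by (rule rev_image_eqI) auto

lemma root_in_verts [simp]: "r \<in> verts r ps"
  by (simp add: verts_def)

fun lab :: "('a \<times> 'a) list \<Rightarrow> 'a set \<Rightarrow> nat" where
  "lab [] = (\<lambda>f. undefined)"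
| "lab ((w, u) # ps) = (lab ps)({w, u} := Suc (length ps))"

definition tree_of :: "'a \<Rightarrow> ('a \<times> 'a) list \<Rightarrow> 'a ltree" where
  "tree_of r ps = (((verts r ps, edges ps), r), lab ps)"

fun grows :: "'a set \<Rightarrow> 'a set set \<Rightarrow> 'a \<Rightarrow> ('a \<times> 'a) list \<Rightarrow> bool" where
  "grows V E r [] \<longleftrightarrow> r \<in> V"
| "grows V E r ((w, u) # ps) \<longleftrightarrow>
     grows V E r ps \<and> w \<in> V \<and> w \<notin> verts r ps \<and> u \<in> verts r ps \<and> {w, u} \<in> E"

lemma grows_verts: "grows V E r ps \<Longrightarrow> verts r ps \<subseteq> V"
  by (induction V E r ps rule: grows.induct) auto

lemma grows_edges: "grows V E r ps \<Longrightarrow> edges ps \<subseteq> E"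
  by (induction V E r ps rule: grows.induct) auto

lemma grows_edge_subset: "grows V E r ps \<Longrightarrow> f \<in> edges ps \<Longrightarrow> f \<subseteq> verts r ps"
  by (induction V E r ps rule: grows.induct) auto

lemma grows_card_edge: "grows V E r ps \<Longrightarrow> f \<in> edges ps \<Longrightarrow> card f = 2"
proof (induction V E r ps rule: grows.induct)
  case (2 V E r w u ps)
  then have "w \<noteq> u" by auto
  then show ?case using 2 by auto
qed simp

lemma grows_distinct: "grows V E r ps \<Longrightarrow> distinct (map fst ps) \<and> r \<notin> fst ` set ps"
  by (induction V E r ps rule: grows.induct) (auto simp: verts_def)

lemma card_verts: "grows V E r ps \<Longrightarrow> card (verts r ps) = Suc (length ps)"
  using grows_distinct[of V E r ps] distinct_card[of "map fst ps"] by (simp add: verts_def)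

lemma grows_new_edge:
  assumes "grows V E r ((w, u) # ps)" "f \<in> edges ps"
  shows "w \<notin> f"
  using grows_edge_subset[of V E r ps f] assms by auto

lemma lab_append:
  "lab (qs @ ps) f = (if f \<in> edges qs then length ps + lab qs f else lab ps f)"
  by (induction qs rule: lab.induct) auto

lemma lab_extensional: "lab ps \<in> extensional (edges ps)"
  by (induction ps rule: lab.induct) (auto simp: extensional_def)

lemma lab_bounds: "f \<in> edges ps \<Longrightarrow> 1 \<le> lab ps f \<and> lab ps f \<le> length ps"
proof (induction ps rule: lab.induct)
  case (2 w u ps)
  then show ?case by (cases "f = {w, u}") auto
qed simp

lemma lab_bij: "grows V E r ps \<Longrightarrow> bij_betw (lab ps) (edges ps) {1..length ps}"
proof (induction V E r ps rule: grows.induct)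
  case (2 V E r w u ps)
  have new: "{w, u} \<notin> edges ps" using grows_new_edge[OF 2(2)] by blast
  have "bij_betw (lab ((w, u) # ps)) (edges ps) {1..length ps}"
    using 2 new by (subst bij_betw_cong[where g = "lab ps"]) auto
  then have "bij_betw (lab ((w, u) # ps)) (edges ps \<union> {{w, u}})
      ({1..length ps} \<union> {lab ((w, u) # ps) {w, u}})"
    by (intro notIn_Un_bij_betw[OF new]) auto
  moreover have "lab ((w, u) # ps) {w, u} = Suc (length ps)" by simp
  moreover have "edges ps \<union> {{w, u}} = edges ((w, u) # ps)" by simp
  moreover have "{1..length ps} \<union> {Suc (length ps)} = {1..length ((w, u) # ps)}" by auto
  ultimately show ?case by (simp only:)
qed (simp add: bij_betw_def)

text \<open>The vertex attached last has degree at most 1 in the given set, hence degree 0; remove it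
  and repeat.\<close>

lemma even_edge_set_empty:
  assumes "grows V E r ps" "C \<subseteq> edges ps" "\<And>v. even (card {f \<in> C. v \<in> f})"
  shows "C = {}"
  using assms
proof (induction V E r ps rule: grows.induct)
  case (2 V E r w u ps)
  have "{w, u} \<notin> C"
  proof
    assume "{w, u} \<in> C"
    then have "{f \<in> C. w \<in> f} = {{w, u}}"
      using 2(3) grows_new_edge[OF 2(2)] by auto
    then show False using 2(4)[of w] by simp
  qed
  then show ?case using 2 by auto
qed simp

lemma grows_acyclic:
  assumes "grows V E r ps"
  shows "\<not> cycle (\<lambda>f. f) (edges ps) vs es"
proof
  assume c: "cycle (\<lambda>f. f) (edges ps) vs es"
  have "set es = {}"
  proof (rule even_edge_set_empty[OF assms])
    show "set es \<subseteq> edges ps" using c by (simp add: cycle_def)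
    show "even (card {f \<in> set es. v \<in> f})" for v
      by (rule even_degree_of_cycle[OF c grows_card_edge[OF assms]])
  qed
  then show False using c by (auto simp: cycle_def)
qed

lemma root_path:
  assumes "grows V E r ps" "v \<in> verts r ps"
  shows "\<exists>p. inj_path (verts r ps) (edges ps) p \<and> hd p = v \<and> last p = r"
  using assms
proof (induction V E r ps arbitrary: v rule: grows.induct)
  case (1 V E r)
  then show ?case by (intro exI[of _ "[r]"]) (auto simp: inj_path_def)
next
  case (2 V E r w u ps)
  let ?z = "if v = w then u else v"
  have "grows V E r ps" "?z \<in> verts r ps" using 2(2,3) by auto
  then obtain p where p: "inj_path (verts r ps) (edges ps) p" "hd p = ?z" "last p = r"
    using 2(1) by blast
  have p': "inj_path (verts r ((w, u) # ps)) (edges ((w, u) # ps)) p"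
    by (rule inj_path_mono[OF p(1)]) auto
  show ?case
  proof (cases "v = w")
    case True
    have "w \<notin> set p" "p \<noteq> []" using p(1) 2(2) by (auto simp: inj_path_def)
    then show ?thesis using True p p'
      by (intro exI[of _ "w # p"]) (simp add: inj_path_Cons_iff)
  next
    case False
    then show ?thesis using p p' by auto
  qed
qed

lemma grows_connected:
  assumes "grows V E r ps"
  shows "connected_graph (verts r ps) (edges ps)"
proof -
  let ?R = "{(x, y). {x, y} \<in> edges ps}"
  have "(v, r) \<in> ?R\<^sup>*" if "v \<in> verts r ps" for v
    using assms that
  proof (induction V E r ps arbitrary: v rule: grows.induct)
    case (2 V E r w u ps)
    let ?R' = "{(x, y). {x, y} \<in> edges ((w, u) # ps)}"
    have sub: "{(x, y). {x, y} \<in> edges ps}\<^sup>* \<subseteq> ?R'\<^sup>*"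
      by (rule rtrancl_mono) (simp add: Collect_mono_iff case_prod_beta)
    show ?case
    proof (cases "v = w")
      case True
      have "grows V E r ps" "u \<in> verts r ps" using 2(2) by auto
      then have "(u, r) \<in> ?R'\<^sup>*" using 2(1) sub by blast
      moreover have "(v, u) \<in> ?R'" using True by simp
      ultimately show ?thesis by (rule converse_rtrancl_into_rtrancl[rotated])
    next
      case False
      then have "grows V E r ps" "v \<in> verts r ps" using 2(2,3) by auto
      then have "(v, r) \<in> {(x, y). {x, y} \<in> edges ps}\<^sup>*" by (rule 2(1))
      then show ?thesis using sub by blast
    qed
  qed simp
  moreover have "sym (?R\<^sup>*)"
    by (rule sym_rtrancl) (simp add: sym_def insert_commute)
  ultimately show ?thesis
    unfolding connected_graph_def by (intro ballI) (blast intro: rtrancl_trans dest: symD)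
qed

text \<open>A path to the root that visits the last vertex \<open>w\<close> must start there, since \<open>w\<close> is a leaf
  other than the root, and its first edge then carries the largest label.\<close>

lemma grows_decreasing:
  assumes "grows V E r ps" "inj_path (verts r ps) (edges ps) p" "last p = r"
  shows "decreasing_along (lab ps) p"
  using assms
proof (induction V E r ps arbitrary: p rule: grows.induct)
  case (1 V E r p)
  have "p = [hd p]"
    using 1 by (cases p rule: remdups_adj.cases) (auto simp: inj_path_def)
  then show ?case by (metis decreasing_along_short length_Cons list.size(3) One_nat_def order_refl)
next
  case (2 V E r w u ps p)
  let ?F = "edges ((w, u) # ps)"
  note new = grows_new_edge[OF 2(2)]
  have at_w: "f = {w, u}" if "f \<in> ?F" "w \<in> f" for f using that new by auto
  have shrink: "inj_path (verts r ps) (edges ps) q \<and> decreasing_along (lab ((w, u) # ps)) q"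
    if q: "inj_path (verts r ((w, u) # ps)) ?F q" "w \<notin> set q" "last q = r" for q
  proof -
    have E: "f \<noteq> {w, u}" if "f \<in> set (path_edges q)" for f
      using path_edges_subset[OF that] q(2) by auto
    have "successively (\<lambda>x y. {x, y} \<in> edges ps) q"
    proof (rule successively_mono)
      show "successively (\<lambda>x y. {x, y} \<in> ?F) q" using q by (simp add: inj_path_def)
    qed (use q(2) in \<open>auto simp: doubleton_eq_iff\<close>)
    then have ip: "inj_path (verts r ps) (edges ps) q"
      using q by (auto simp: inj_path_def)
    then have "decreasing_along (lab ps) q" using 2 q(3) by auto
    moreover have "lab ps f = lab ((w, u) # ps) f" if "f \<in> set (path_edges q)" for f
      using E[OF that] by simp
    ultimately show ?thesis using ip decreasing_along_cong by metis
  qed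
  show ?case
  proof (cases "w \<in> set p")
    case False
    then show ?thesis using shrink 2 by blast
  next
    case True
    then obtain a b where ab: "p = a @ w # b" by (auto simp: in_set_conv_decomp)
    have "r \<noteq> w" using 2(2) by auto
    then have "b \<noteq> []" using 2(4) ab by auto
    then obtain c d where b: "b = c # d" by (cases b) auto
    have wc: "{w, c} \<in> ?F"
      using 2(3) ab b by (simp add: inj_path_def successively_append_iff)
    have dist: "distinct p" using 2(3) by (simp add: inj_path_def)
    have c: "c = u" using at_w[OF wc] dist ab b by (auto simp: doubleton_eq_iff)
    \<comment> \<open>If the path entered \<open>w\<close> before leaving it, both neighbours on the path would be \<open>u\<close>.\<close>
    have "a = []"
    proof (rule ccontr)
      assume a: "a \<noteq> []"
      then have "{last a, w} \<in> ?F"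
        using 2(3) ab b by (simp add: inj_path_def successively_append_iff)
      then have "last a = u" using at_w[of "{last a, w}"] dist ab a last_in_set[OF a]
        by (auto simp: doubleton_eq_iff)
      then show False using c dist ab b a last_in_set[OF a] by auto
    qed
    then have p: "p = w # u # d" using ab b c by simp
    have ip: "inj_path (verts r ((w, u) # ps)) ?F (u # d)"
      using 2(3) p inj_path_Cons_iff[of _ _ w "u # d"] by auto
    have wnot: "w \<notin> set (u # d)" using dist p by auto
    have lr: "last (u # d) = r" using 2(4) p by simp
    note sh = shrink[OF ip wnot lr]
    have "lab ((w, u) # ps) f < lab ((w, u) # ps) {w, u}" if f: "f \<in> set (path_edges (u # d))" for f
    proof -
      have "f \<in> edges ps" using f sh path_edges_in_graph by (auto simp: inj_path_def)
      moreover have "f \<noteq> {w, u}" using path_edges_subset[OF f] wnot by auto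
      ultimately show ?thesis using lab_bounds[of f ps] by simp
    qed
    then show ?thesis
      unfolding p decreasing_along_Cons using sh by (intro conjI ballI) (simp_all only:)
  qed
qed

lemma tree_of_in_labelled_trees_at:
  assumes "grows V E r ps"
  shows "tree_of r ps \<in> labelled_trees_at V E (Suc (length ps)) r"
proof -
  have "subtree V E (verts r ps) (edges ps)"
    unfolding subtree_def
    using grows_verts[OF assms] grows_edges[OF assms] grows_edge_subset[OF assms]
      grows_connected[OF assms] grows_acyclic[OF assms] by (intro conjI ballI notI) blast+
  then show ?thesis
    unfolding labelled_trees_at_def tree_of_def
    using card_verts[OF assms] lab_extensional[of ps] lab_bij[OF assms] grows_decreasing[OF assms]
    by auto
qed

section \<open>Every decreasing labelled tree has a history\<close>

lemma edge_endpoints: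
  assumes "finite_graph V E" "f \<in> E"
  obtains a b where "f = {a, b}"
  using assms unfolding finite_graph_def by meson

text \<open>An extension of maximal length starts at a leaf: any further edge at its first vertex would
  either prolong the path or close a cycle.\<close>

lemma extend_to_leaf:
  assumes G: "finite_graph V E" and T: "subtree V E W F"
    and p: "inj_path W F p" "last p = r" "2 \<le> length p"
  shows "\<exists>q. inj_path W F (q @ p) \<and> leaf F r (hd (q @ p))"
proof -
  have "finite W" using G T finite_subset by (auto simp: finite_graph_def subtree_def)
  have bound: "length q \<le> card W" if "inj_path W F (q @ p)" for q
  proof -
    have "length q + length p = card (set (q @ p))"
      using that distinct_card[of "q @ p"] by (simp add: inj_path_def)
    also have "\<dots> \<le> card W"
      using that \<open>finite W\<close> by (intro card_mono) (auto simp: inj_path_def)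
    finally show ?thesis by simp
  qed
  obtain q where q: "inj_path W F (q @ p)"
    and max: "\<And>q'. inj_path W F (q' @ p) \<Longrightarrow> length q' \<le> length q"
    using ex_has_greatest_nat[of "\<lambda>q. inj_path W F (q @ p)" "[]" length "Suc (card W)"] p bound
    by (auto simp: less_Suc_eq_le le_Suc_eq)
  have "2 \<le> length (q @ p)" using p(3) by simp
  then obtain h s t where hst: "q @ p = h # s # t"
    by (cases "q @ p" rule: remdups_adj.cases) auto
  have ip: "inj_path W F (h # s # t)" using q hst by simp
  have "p \<noteq> []" using p(3) by auto
  then have "last (h # s # t) = r" using p(2) by (simp flip: hst)
  then have "h \<noteq> r" using inj_path_last_ne[OF ip] by auto
  have hs: "{h, s} \<in> F" and h: "h \<in> W" "h \<notin> set (s # t)"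
    using inj_path_Cons_iff[of W F h "s # t"] ip by auto
  have noc: "\<not> cycle (\<lambda>f. f) F vs es" for vs es using T by (auto simp: subtree_def)
  have only: "f = {h, s}" if f: "f \<in> F" "h \<in> f" for f
  proof (rule ccontr)
    assume ne: "f \<noteq> {h, s}"
    have "f \<in> E" "f \<subseteq> W" using T f by (auto simp: subtree_def)
    obtain a b where "f = {a, b}" using edge_endpoints[OF G \<open>f \<in> E\<close>] .
    with f(2) have "f = {h, if a = h then b else a}" by (auto simp: insert_commute)
    with \<open>f \<subseteq> W\<close> obtain z where z: "f = {h, z}" "z \<in> W" by (metis insert_subset)
    have "z \<noteq> s" using ne z by auto
    have "z \<noteq> h"
    proof
      assume "z = h"
      then have "cycle (\<lambda>f. f) F [h] [f]" using z f by (simp add: cycle_def)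
      then show False using noc by blast
    qed
    show False
    \<comment> \<open>A neighbour off the path prolongs it; a neighbour on the path closes a cycle with it.\<close>
    proof (cases "z \<in> set (q @ p)")
      case False
      have "{z, h} \<in> F" using f z by (simp add: insert_commute)
      then have "inj_path W F (z # h # s # t)"
        using inj_path_Cons_iff[of W F z "h # s # t"] z False ip hst by simp
      then have "inj_path W F ((z # q) @ p)" using hst by simp
      from max[OF this] show False by simp
    next
      case True
      then have "z \<in> set t" using \<open>z \<noteq> s\<close> \<open>z \<noteq> h\<close> hst by auto
      then obtain a b where t: "t = a @ z # b" by (auto simp: in_set_conv_decomp)
      define c where "c = h # s # a @ [z]"
      have ic: "inj_path W F c"
        using inj_path_prefix[of W F c b] ip t by (simp add: c_def)
      have "cycle (\<lambda>f. f) F c (path_edges c @ [f])"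
      proof (rule cycle_from_path)
        have "f \<notin> set (path_edges (s # a @ [z]))"
          using path_edges_subset[of f "s # a @ [z]"] f(2) h(2) t by auto
        then show "f \<notin> set (path_edges c)" using ne by (simp add: c_def)
        show "insert f (set (path_edges c)) \<subseteq> F"
          using f inj_path_edges[OF ic] by simp
        show "f = {last c, hd c}" using z by (auto simp: c_def)
      qed (use ic distinct_path_edges[of c] in \<open>auto simp: inj_path_def\<close>)
      then show False using noc by blast
    qed
  qed
  have "{f \<in> F. h \<in> f} = {{h, s}}"
  proof (intro equalityI subsetI)
    fix f assume "f \<in> {f \<in> F. h \<in> f}"
    then show "f \<in> {{h, s}}" using only[of f] by simp
  qed (use hs in simp)
  then have "leaf F r h" using \<open>h \<noteq> r\<close> by (simp add: leaf_def)
  then show ?thesis using q hst by (intro exI[of _ q]) simp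
qed

text \<open>The definition of \<^const>\<open>labelled_trees_at\<close> speaks of paths that start at a leaf. Suffixes of
  decreasing sequences being decreasing, it suffices to extend an arbitrary path to a leaf.\<close>

lemma root_paths_decreasing:
  assumes G: "finite_graph V E" and x: "(((W, F), r), L) \<in> labelled_trees_at V E n r"
    and p: "inj_path W F p" "last p = r"
  shows "decreasing_along L p"
proof (cases "2 \<le> length p")
  case True
  have T: "subtree V E W F"
    and dec: "\<And>p. inj_path W F p \<Longrightarrow> leaf F r (hd p) \<Longrightarrow> last p = r \<Longrightarrow> decreasing_along L p"
    using x by (auto simp: labelled_trees_at_def)
  from extend_to_leaf[OF G T p True]
  obtain q where q: "inj_path W F (q @ p)" "leaf F r (hd (q @ p))" by blast
  have "p \<noteq> []" using True by auto
  then have "last (q @ p) = r" using p(2) by simp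
  from dec[OF q this] show ?thesis by (rule decreasing_along_suffix)
qed (simp add: decreasing_along_short)

text \<open>The edge with the largest label ends in a leaf: if a path to the root that starts with
  this edge could be prolonged backwards, the edge before it would need a still larger label.
  Removing the edge and the leaf leaves a smaller tree of the same kind, whose history is
  continued by the removed pair.\<close>

lemma labelled_tree_imp_tree_of:
  assumes G: "finite_graph V E"
  shows "(((W, F), r), L) \<in> labelled_trees_at V E (Suc n) r \<Longrightarrow>
    \<exists>ps. grows V E r ps \<and> length ps = n \<and> (((W, F), r), L) = tree_of r ps"
proof (induction n arbitrary: W F L)
  case 0
  then have "card W = 1" "r \<in> W" "bij_betw L F {}" "L \<in> extensional F" "W \<subseteq> V"
    by (auto simp: labelled_trees_at_def subtree_def)
  then have "W = {r}" "F = {}" "L = (\<lambda>f. undefined)" "r \<in> V"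
    by (auto simp: bij_betw_def card_1_singleton_iff)
  then show ?case by (intro exI[of _ "[]"]) (simp add: tree_of_def)
next
  case (Suc n)
  then have T: "subtree V E W F" and cW: "card W = Suc (Suc n)" and rW: "r \<in> W"
    and ext: "L \<in> extensional F" and bij: "bij_betw L F {1..Suc n}"
    by (auto simp: labelled_trees_at_def)
  have sub: "\<And>f. f \<in> F \<Longrightarrow> f \<subseteq> W" and FE: "F \<subseteq> E" and WV: "W \<subseteq> V"
    and con: "connected_graph W F" and noc: "\<And>vs es. \<not> cycle (\<lambda>f. f) F vs es"
    using T by (auto simp: subtree_def)
  obtain f where f: "f \<in> F" "L f = Suc n"
    using bij unfolding bij_betw_def by (metis atLeastAtMost_iff imageE le_add1 order_refl plus_1_eq_Suc)
  obtain a b where ab: "f = {a, b}" using edge_endpoints[OF G] f(1) FE by (metis subsetD)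
  have abW: "a \<in> W" "b \<in> W" using sub[OF f(1)] ab by auto
  have "a \<noteq> b"
  proof
    assume "a = b"
    then have "cycle (\<lambda>f. f) F [a] [f]" using ab f by (simp add: cycle_def)
    then show False using noc by blast
  qed
  \<comment> \<open>One orientation of the edge starts an injective path to the root: if the path from \<open>a\<close>
      visits \<open>b\<close>, replace its part before \<open>b\<close> by the edge, otherwise put \<open>b\<close> in front.\<close>
  have "\<exists>w u p. f = {w, u} \<and> inj_path W F (w # u # p) \<and> last (u # p) = r"
  proof -
    have "(a, r) \<in> {(x, y). {x, y} \<in> F}\<^sup>*" using con abW rW by (simp add: connected_graph_def)
    from walk_imp_inj_path[OF this rW sub]
    obtain p where p: "inj_path W F p" "hd p = a" "last p = r" by blast
    then obtain p' where p': "p = a # p'" by (cases p) (auto simp: inj_path_def)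
    show ?thesis
    proof (cases "b \<in> set p")
      case False
      have "inj_path W F (b # a # p')"
        using inj_path_Cons_iff[of W F b "a # p'"] p p' False abW f ab
        by (simp add: insert_commute)
      then show ?thesis using ab p p' by (intro exI[of _ b] exI[of _ a] exI[of _ p']) auto
    next
      case True
      then have "b \<in> set p'" using p' \<open>a \<noteq> b\<close> by auto
      then obtain c d where cd: "p' = c @ b # d" by (auto simp: in_set_conv_decomp)
      have "a \<notin> set (b # d)" using p p' cd by (auto simp: inj_path_def)
      moreover have "inj_path W F (b # d)"
        using inj_path_suffix[of W F "a # c" "b # d"] p p' cd by simp
      ultimately have "inj_path W F (a # b # d)"
        using inj_path_Cons_iff[of W F a "b # d"] abW f ab by simp
      then show ?thesis using ab p p' cd by (intro exI[of _ a] exI[of _ b] exI[of _ d]) auto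
    qed
  qed
  then obtain w u p where fwu: "f = {w, u}" and wup: "inj_path W F (w # u # p)" "last (u # p) = r"
    by blast
  obtain q where q: "inj_path W F (q @ w # u # p)" "leaf F r (hd (q @ w # u # p))"
    using extend_to_leaf[OF G T wup(1)] wup(2) by auto
  have "q = []"
  proof (rule ccontr)
    assume "q \<noteq> []"
    then obtain h q' where h: "q = h # q'" by (cases q) auto
    obtain s t where st: "q' @ w # u # p = s # t" by (cases "q' @ w # u # p") auto
    have eq: "q @ w # u # p = h # s # t" using h st by simp
    have "last (q @ w # u # p) = r" using wup(2) by simp
    from root_paths_decreasing[OF G Suc.prems q(1) this]
    have "decreasing_along L (h # s # t)" by (simp only: eq)
    moreover have "f \<in> set (path_edges (s # t))"
      using edge_in_path_edges[of w u q' p] st fwu by simp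
    ultimately have "Suc n < L {h, s}" using f(2) decreasing_along_Cons[of L h s t] by auto
    moreover have "{h, s} \<in> F" using q(1) unfolding eq by (simp add: inj_path_def)
    then have "L {h, s} \<le> Suc n" using bij by (auto simp: bij_betw_def)
    ultimately show False by simp
  qed
  then have "leaf F r w" using q(2) by simp
  then have "w \<noteq> r" and c1: "card {g \<in> F. w \<in> g} = 1" by (auto simp: leaf_def)
  have wu: "w \<in> W" "u \<in> W" "w \<noteq> u"
    using wup(1) by (auto simp: inj_path_def)
  have only: "g = f" if "g \<in> F" "w \<in> g" for g
  proof -
    have "g \<in> {g \<in> F. w \<in> g}" "f \<in> {g \<in> F. w \<in> g}" using that f fwu by auto
    then show ?thesis using c1 by (metis card_1_singletonE singletonD)
  qed
  let ?W = "W - {w}" and ?F = "F - {f}" and ?L = "restrict L (F - {f})"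
  have subF: "g \<subseteq> ?W" if "g \<in> ?F" for g using that sub[of g] only[of g] by auto
  have "connected_graph ?W ?F"
  proof -
    let ?R = "{(x, y). {x, y} \<in> F}" and ?R' = "{(x, y). {x, y} \<in> ?F}"
    \<comment> \<open>Folding the leaf onto its neighbour turns walks in the tree into walks that avoid the leaf.\<close>
    define \<phi> where "\<phi> x = (if x = w then u else x)" for x
    have "(\<phi> x, \<phi> y) \<in> ?R'\<^sup>*" if "(x, y) \<in> ?R\<^sup>*" for x y
      using that
    proof (induction rule: rtrancl_induct)
      case (step y z)
      have yz: "{y, z} \<in> F" using step by simp
      have "(\<phi> y, \<phi> z) \<in> ?R'\<^sup>*"
      proof (cases "{y, z} = f")
        case True
        then have "\<phi> y = \<phi> z" using fwu by (auto simp: \<phi>_def doubleton_eq_iff)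
        then show ?thesis by simp
      next
        case False
        then have "w \<notin> {y, z}" using only[OF yz] by auto
        then have "(\<phi> y, \<phi> z) \<in> ?R'" using False yz by (auto simp: \<phi>_def)
        then show ?thesis by (rule r_into_rtrancl)
      qed
      then show ?case using step.IH by (rule rtrancl_trans[rotated])
    qed simp
    then have retract: "(\<phi> x, \<phi> y) \<in> ?R'\<^sup>*" if "x \<in> W" "y \<in> W" for x y
      using con that by (simp add: connected_graph_def)
    show ?thesis
      unfolding connected_graph_def
    proof (intro ballI)
      fix x y assume "x \<in> ?W" "y \<in> ?W"
      then have "x \<in> W" "y \<in> W" "\<phi> x = x" "\<phi> y = y" by (auto simp: \<phi>_def)
      then show "(x, y) \<in> ?R'\<^sup>*" using retract[of x y] by simp
    qed
  qed
  moreover have "\<not> cycle (\<lambda>f. f) ?F vs es" for vs es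
    using noc cycle_mono[of "\<lambda>f. f" ?F vs es F] by blast
  ultimately have T': "subtree V E ?W ?F"
    using WV FE subF unfolding subtree_def by blast
  have "bij_betw ?L ?F {1..n}"
  proof -
    have "L ` ?F = L ` F - L ` {f}"
      using bij f by (intro inj_on_image_set_diff[of L F]) (auto simp: bij_betw_def)
    also have "\<dots> = {1..n}" using bij f by (auto simp: bij_betw_def)
    finally have "bij_betw L ?F {1..n}"
      using bij by (auto simp: bij_betw_def intro: inj_on_subset)
    then show ?thesis by (subst bij_betw_cong[where g = L]) auto
  qed
  moreover have "decreasing_along ?L p" if "inj_path ?W ?F p" "last p = r" for p
  proof -
    have "inj_path W F p" by (rule inj_path_mono[OF that(1)]) auto
    from root_paths_decreasing[OF G Suc.prems this that(2)]
    have "decreasing_along L p" .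
    moreover have "set (path_edges p) \<subseteq> ?F"
      by (rule inj_path_edges[OF that(1)])
    then have "L g = ?L g" if "g \<in> set (path_edges p)" for g using that by auto
    ultimately show ?thesis using decreasing_along_cong by metis
  qed
  moreover have "card ?W = Suc n" using cW wu by simp
  ultimately have "(((?W, ?F), r), ?L) \<in> labelled_trees_at V E (Suc n) r"
    using T' rW \<open>w \<noteq> r\<close> by (simp add: labelled_trees_at_def)
  from Suc.IH[OF this] obtain ps where ps: "grows V E r ps" "length ps = n"
    and eq: "?W = verts r ps" "?F = edges ps" "?L = lab ps"
    unfolding tree_of_def prod.inject by metis
  have "W = insert w (verts r ps)" "F = insert f (edges ps)"
    unfolding eq(1,2)[symmetric] using wu f by auto
  then have WF: "W = verts r ((w, u) # ps)" "F = edges ((w, u) # ps)"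
    unfolding fwu by simp_all
  have "L g = lab ((w, u) # ps) g" for g
  proof (cases "g = f")
    case True
    then show ?thesis using f(2) fwu ps by simp
  next
    case False
    have "lab ps g = ?L g" using eq by simp
    then show ?thesis using False ext fwu
      by (cases "g \<in> F") (auto simp: extensional_def)
  qed
  then have "L = lab ((w, u) # ps)" by (rule HOL.ext)
  with WF have "(((W, F), r), L) = tree_of r ((w, u) # ps)" by (simp only: tree_of_def)
  moreover have "grows V E r ((w, u) # ps)"
    unfolding grows.simps eq(1)[symmetric] using ps wu WV FE f(1) unfolding fwu by auto
  ultimately show ?case using ps(2) by (intro exI[of _ "(w, u) # ps"] conjI) simp_all
qed

text \<open>The labelling is arbitrary except for the position of its maximum, because a step to a
  vertex outside the tree removes an edge while labels still start at 0.\<close>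

lemma remove_newest:
  assumes g: "grows V E r ((w, u) # ps)" and big: "\<And>f. f \<in> edges ps \<Longrightarrow> L f < L {w, u}"
  shows "remove_max (((verts r ((w, u) # ps), edges ((w, u) # ps)), r), L) =
    (((verts r ps, edges ps), r), restrict L (edges ps))"
proof -
  let ?F = "edges ((w, u) # ps)"
  note new = grows_new_edge[OF g]
  have w: "w \<notin> verts r ps" "u \<in> verts r ps" using g by auto
  have Max: "Max (L ` ?F) = L {w, u}"
    using big by (intro Max_eqI) (auto simp: less_imp_le)
  have f: "(THE f. f \<in> ?F \<and> L f = Max (L ` ?F)) = {w, u}"
    unfolding Max
  proof (intro the_equality)
    fix f assume "f \<in> ?F \<and> L f = L {w, u}"
    then show "f = {w, u}" using big[of f] by (cases "f = {w, u}") auto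
  qed simp
  have deg: "{f \<in> ?F. w \<in> f} = {{w, u}}" using new by auto
  have "w \<noteq> r" using w by auto
  then have "leaf ?F r w" unfolding leaf_def deg by simp
  moreover have "\<not> leaf ?F r u"
  proof
    assume "leaf ?F r u"
    then have ur: "u \<noteq> r \<and> card {f \<in> ?F. u \<in> f} = 1" unfolding leaf_def .
    then obtain x where "(u, x) \<in> set ps" using w(2) by (auto simp: verts_def)
    then have ux: "{u, x} \<in> edges ps" by (rule pair_in_edges)
    then have "{u, x} \<noteq> {w, u}" using new[OF ux] by auto
    moreover have "{u, x} \<in> {f \<in> ?F. u \<in> f}" "{w, u} \<in> {f \<in> ?F. u \<in> f}" using ux by auto
    ultimately show False using ur by (metis card_1_singletonE singletonD)
  qed
  ultimately have v: "(THE v. leaf ?F r v \<and> v \<in> {w, u}) = w"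
    by (intro the_equality) auto
  have "?F - {{w, u}} = edges ps" "verts r ((w, u) # ps) - {w} = verts r ps"
    using new w by auto
  then show ?thesis by (simp only: remove_max.simps Let_def f v)
qed

lemma remove_max_tree_of:
  assumes g: "grows V E r (a # ps)"
  shows "remove_max (tree_of r (a # ps)) = tree_of r ps"
proof -
  obtain w u where a: "a = (w, u)" by (cases a)
  have ne: "f \<noteq> {w, u}" if "f \<in> edges ps" for f
    using grows_new_edge[OF g[unfolded a] that] by auto
  have "restrict (lab (a # ps)) (edges ps) = lab ps"
    using ne lab_extensional[of ps] a by (auto simp: restrict_def extensional_def)
  moreover have "lab (a # ps) f < lab (a # ps) {w, u}" if "f \<in> edges ps" for f
    using lab_bounds[OF that] ne[OF that] a by simp
  ultimately show ?thesis
    using remove_newest[OF g[unfolded a], of "lab (a # ps)"] a by (simp add: tree_of_def)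
qed

section \<open>A step moves the new root to the front\<close>

lemma verts_new_root [simp]: "verts v (ps @ [(r, v)]) = insert v (verts r ps)"
  by (auto simp: verts_def)

lemma grows_new_root:
  assumes "grows V E r ps" "v \<in> V" "v \<notin> verts r ps" "{r, v} \<in> E"
  shows "grows V E v (ps @ [(r, v)])"
  using assms by (induction V E r ps rule: grows.induct) auto

text \<open>The pairs in \<open>ps\<close> are older than \<open>(v, u)\<close> and do not refer to \<open>v\<close>; those in \<open>qs\<close> may be attached
  to \<open>v\<close>, which remains available as the new root.\<close>

lemma grows_reroot:
  assumes "grows V E r (qs @ (v, u) # ps)" "{r, v} \<in> E"
  shows "grows V E v (qs @ ps @ [(r, v)])"
  using assms
proof (induction qs)
  case Nil
  then show ?case by (auto intro: grows_new_root)
next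
  case (Cons a qs)
  obtain w x where a: "a = (w, x)" by (cases a)
  have "verts v (qs @ ps @ [(r, v)]) = verts r (qs @ (v, u) # ps)"
    by (auto simp: verts_def)
  then show ?case using Cons a by simp
qed

lemma even_card_sym_diff:
  assumes "finite A" "finite B" "even (card {d \<in> A. P d})" "even (card {d \<in> B. P d})"
  shows "even (card {d \<in> (A - B) \<union> (B - A). P d})"
proof -
  let ?A = "{d \<in> A. P d}" and ?B = "{d \<in> B. P d}"
  have fin: "finite ?A" "finite ?B" using assms by auto
  have "{d \<in> (A - B) \<union> (B - A). P d} = (?A - ?B) \<union> (?B - ?A)" by auto
  also have "card \<dots> = card (?A - ?B) + card (?B - ?A)"
    using fin by (intro card_Un_disjoint) auto
  finally have "card {d \<in> (A - B) \<union> (B - A). P d} + 2 * card (?A \<inter> ?B) = card ?A + card ?B"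
    using card_Diff_subset_Int[of ?A ?B] card_Diff_subset_Int[of ?B ?A] fin
      card_mono[of ?A "?A \<inter> ?B"] card_mono[of ?B "?A \<inter> ?B"]
    by (simp add: Int_commute)
  moreover have "even (card ?A + card ?B)" using assms(3,4) by simp
  ultimately have "even (card {d \<in> (A - B) \<union> (B - A). P d} + 2 * card (?A \<inter> ?B))" by simp
  then show ?thesis by (rule dvd_add_left_iff[THEN iffD1, rotated]) simp
qed

text \<open>The symmetric difference of two cycles has even degrees. Both cycles use the additional
  edge, since the tree alone has no cycle, so the symmetric difference lies in the tree and
  is empty.\<close>

lemma unique_cycle:
  assumes g: "grows V E r ps" and "r \<noteq> v"
    and D: "D = insert ({r, v}, j) ((\<lambda>f. (f, L f)) ` edges ps)"
    and c: "cycle fst D vs es" and c': "cycle fst D vs' es'"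
  shows "set es = set es'"
proof -
  let ?G = "(\<lambda>f. (f, L f)) ` edges ps" and ?e = "({r, v}, j)"
  have loopfree: "card (fst d) = 2" if "d \<in> D" for d
    using that grows_card_edge[OF g] \<open>r \<noteq> v\<close> D by auto
  have even: "even (card {d \<in> set es. x \<in> fst d})" if "cycle fst D vs es" for vs es x
    using even_degree_of_cycle[OF that] loopfree by blast
  have forest: "C = {}" if C: "C \<subseteq> ?G" "\<And>x. even (card {d \<in> C. x \<in> fst d})" for C
  proof -
    have "fst ` C = {}"
    proof (rule even_edge_set_empty[OF g])
      show "fst ` C \<subseteq> edges ps" using C by auto
      fix x
      have "{f \<in> fst ` C. x \<in> f} = fst ` {d \<in> C. x \<in> fst d}" by auto
      moreover have "inj_on fst {d \<in> C. x \<in> fst d}"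
        using C(1) by (auto simp: inj_on_def)
      ultimately show "even (card {f \<in> fst ` C. x \<in> f})" using C(2) by (simp add: card_image)
    qed
    then show ?thesis by simp
  qed
  have e: "?e \<in> set es" if "cycle fst D vs es" for vs es
  proof (rule ccontr)
    assume "?e \<notin> set es"
    then have "set es \<subseteq> ?G" using that D by (auto simp: cycle_def)
    from forest[OF this even[OF that]] show False using that by (auto simp: cycle_def)
  qed
  have "(set es - set es') \<union> (set es' - set es) = {}"
  proof (rule forest)
    show "(set es - set es') \<union> (set es' - set es) \<subseteq> ?G"
      using c c' e[OF c] e[OF c'] D by (auto simp: cycle_def)
  qed (intro even_card_sym_diff even[OF c] even[OF c'] finite_set)
  then show ?thesis by blast
qed

lemma relabel_simps: "m < i \<Longrightarrow> relabel m i = i" "i \<le> m \<Longrightarrow> relabel m i = Suc i"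
  by (auto simp: relabel_def)

text \<open>After \<open>{r, v}\<close> has received the label 0, every label is one less than in the history
  \<^term>\<open>ps @ [(r, v)]\<close>. Adding 1 to all labels below the removed maximum compensates for this. For a
  single vertex the removed edge is \<open>{r, v}\<close> itself.\<close>

lemma extend_erase_tree_of:
  assumes g: "grows V E r ps" and v: "v \<in> V" "v \<notin> verts r ps" "{r, v} \<in> E"
  shows "extend_erase (tree_of r ps) v = tree_of v (tl (ps @ [(r, v)]))"
proof -
  obtain w u qs where qs: "ps @ [(r, v)] = (w, u) # qs" by (cases "ps @ [(r, v)]") auto
  have g': "grows V E v ((w, u) # qs)" using grows_new_root[OF g v] qs by simp
  define L where "L = (lab ps)({r, v} := 0)"
  have new: "{r, v} \<notin> edges ps" using grows_edge_subset[OF g] v(2) by blast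
  have L: "lab ((w, u) # qs) f = Suc (L f)" if "f \<in> edges ((w, u) # qs)" for f
    using that new unfolding qs[symmetric] by (auto simp: lab_append L_def)
  have top: "L {w, u} = length qs" using L[of "{w, u}"] by simp
  have less: "L f < length qs \<and> lab qs f = Suc (L f)" if f: "f \<in> edges qs" for f
  proof -
    have "f \<noteq> {w, u}" using grows_new_edge[OF g' f] by auto
    then have "lab qs f = Suc (L f)" using L[of f] f by simp
    then show ?thesis using lab_bounds[OF f] by simp
  qed
  have W: "insert v (verts r ps) = verts v ((w, u) # qs)"
    unfolding qs[symmetric] by simp
  have F: "insert {r, v} (edges ps) = edges ((w, u) # qs)"
    unfolding qs[symmetric] by auto
  have Max: "Max (L ` edges ((w, u) # qs)) = length qs"
    using less top by (intro Max_eqI) (auto simp: less_imp_le)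
  have rm: "remove_max (((verts v ((w, u) # qs), edges ((w, u) # qs)), v), L) =
      (((verts v qs, edges qs), v), restrict L (edges qs))"
    by (rule remove_newest[OF g']) (simp add: less top)
  have "(\<lambda>f\<in>edges qs. relabel (length qs) (restrict L (edges qs) f)) = lab qs"
  proof
    fix f
    show "(\<lambda>f\<in>edges qs. relabel (length qs) (restrict L (edges qs) f)) f = lab qs f"
      using less[of f] lab_extensional[of qs]
      by (cases "f \<in> edges qs") (auto simp: relabel_simps extensional_def)
  qed
  then have "extend_erase (tree_of r ps) v = tree_of v qs"
    by (simp only: extend_erase_def tree_of_def prod.case Let_def W F rm Max snd_conv
        flip: L_def)
  then show ?thesis using qs by simp
qed

text \<open>All edges of the path from \<open>v\<close> to \<open>r\<close> are at most as recent as \<open>(v, u)\<close>, so the maximum on the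
  cycle is the label \<^term>\<open>Suc (length ps)\<close> of \<open>{v, u}\<close>. Discarding this edge and appending \<open>(r, v)\<close> at
  the old end of the history moves the edges in \<open>ps\<close> up by one position and leaves those
  in \<open>qs\<close> where they were, which is what \<^const>\<open>relabel\<close> does.\<close>

lemma close_cycle_tree_of:
  assumes g: "grows V E r (qs @ (v, u) # ps)" and rv: "{r, v} \<in> E"
  shows "close_cycle (tree_of r (qs @ (v, u) # ps)) v = tree_of v (qs @ ps @ [(r, v)])"
proof -
  let ?ps = "qs @ (v, u) # ps" and ?ps' = "qs @ ps @ [(r, v)]" and ?m = "Suc (length ps)"
  define F where "F = edges ?ps"
  define L where "L = lab ?ps"
  define D where "D = insert ({r, v}, 0) ((\<lambda>f. (f, L f)) ` F)"
  have gs: "grows V E r ((v, u) # ps)" using g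
    by (induction qs) auto
  have "r \<noteq> v" using gs by auto
  have bij: "bij_betw L F {1..length ?ps}" unfolding L_def F_def by (rule lab_bij[OF g])
  have inj: "inj_on L F" and pos: "\<And>f. f \<in> F \<Longrightarrow> L f \<ge> 1"
    using bij by (auto simp: bij_betw_def)
  have Lqs: "L f = ?m + lab qs f" if "f \<in> edges qs" for f
    using that by (simp add: L_def lab_append)
  have disj: "f \<notin> edges qs" if "f \<in> edges ((v, u) # ps)" for f
    using g that
  proof (induction qs)
    case (Cons a qs)
    obtain w x where a: "a = (w, x)" by (cases a)
    have "f \<subseteq> verts r (qs @ (v, u) # ps)"
      using grows_edge_subset[of V E r "qs @ (v, u) # ps" f] Cons.prems a by auto
    then show ?case using Cons a by auto
  qed simp
  have Lps: "L f = lab ((v, u) # ps) f" if "f \<in> edges ((v, u) # ps)" for f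
    using disj[OF that] unfolding L_def lab_append by simp
  have vu: "{v, u} \<in> F" "L {v, u} = ?m" using Lps by (simp_all add: F_def)
  obtain p where p: "inj_path (verts r ps) (edges ps) p" "hd p = u" "last p = r"
    using root_path[of V E r ps u] gs by auto
  have p': "p \<noteq> []" "v \<notin> set p" "distinct (v # p)" using p(1) gs by (auto simp: inj_path_def)
  obtain p0 where p0: "p = u # p0" using p p' by (cases p) auto
  have sub: "set (path_edges p) \<subseteq> edges ps" by (rule inj_path_edges[OF p(1)])
  let ?es = "map (\<lambda>f. (f, L f)) (path_edges (v # p))"
  have pe: "path_edges (v # p) = {v, u} # path_edges p" by (simp add: p0)
  have peF: "set (path_edges (v # p)) \<subseteq> edges ((v, u) # ps)" using sub by (auto simp: pe)
  have PF: "set (path_edges (v # p)) \<subseteq> F" using peF by (auto simp: F_def)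
  have cyc: "cycle fst D (v # p) (?es @ [({r, v}, 0)])"
  proof (rule cycle_from_path)
    show "map fst ?es = path_edges (v # p)" by (simp add: comp_def)
    show "distinct ?es"
      using distinct_path_edges[OF p'(3)] by (simp add: distinct_map inj_on_def)
    show "({r, v}, 0) \<notin> set ?es"
    proof
      assume "({r, v}, 0) \<in> set ?es"
      then have "{r, v} \<in> set (path_edges (v # p))" "L {r, v} = 0" by auto
      then show False using pos[of "{r, v}"] PF by auto
    qed
    show "insert ({r, v}, 0) (set ?es) \<subseteq> D" using PF unfolding D_def by auto
    show "fst ({r, v}, 0) = {last (v # p), hd (v # p)}" using p p' by simp
  qed (use p' in auto)
  define C where "C = set (?es @ [({r, v}, 0)])"
  have the_C: "(THE C. \<exists>vs es. cycle fst D vs es \<and> C = set es) = C"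
  proof (rule the_equality)
    show "\<exists>vs es. cycle fst D vs es \<and> C = set es" using cyc C_def by blast
    show "C' = C" if "\<exists>vs es. cycle fst D vs es \<and> C' = set es" for C'
      using that cyc unique_cycle[OF g \<open>r \<noteq> v\<close> D_def[unfolded F_def]] C_def by blast
  qed
  have Max: "Max (snd ` C) = ?m"
  proof (rule Max_eqI)
    show "finite (snd ` C)" by (simp add: C_def)
    show "?m \<in> snd ` C" using vu by (auto simp: C_def pe)
    show "y \<le> ?m" if y: "y \<in> snd ` C" for y
    proof -
      have "y = 0 \<or> y \<in> L ` set (path_edges (v # p))" using y by (auto simp: C_def)
      then consider "y = 0" | f where "f \<in> edges ((v, u) # ps)" "y = L f" using peF by blast
      then show ?thesis
      proof cases
        case 2
        then show ?thesis using lab_bounds[OF 2(1)] Lps[OF 2(1)] by simp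
      qed simp
    qed
  qed
  define D1 where "D1 = {d \<in> D. snd d \<noteq> ?m}"
  have m_iff: "L f = ?m \<longleftrightarrow> f = {v, u}" if "f \<in> F" for f
    using inj vu that by (metis inj_onD)
  have F_minus: "F - {{v, u}} = edges qs \<union> edges ps"
    using disj[of "{v, u}"] grows_new_edge[OF gs, of "{v, u}"] by (auto simp: F_def)
  have D1: "D1 = insert ({r, v}, 0) ((\<lambda>f. (f, L f)) ` (edges qs \<union> edges ps))"
    unfolding D1_def D_def F_minus[symmetric] using m_iff by auto
  have F1: "fst ` D1 = edges ?ps'"
    unfolding D1 by (simp add: image_image image_Un)
  \<comment> \<open>If \<open>{r, v}\<close> is an edge of the tree, then it is \<open>{v, u}\<close>, which has been discarded; so in the
      new tree this edge comes with the label 0 only.\<close>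
  have rv_new: "{r, v} \<notin> edges qs \<union> edges ps"
  proof
    assume "{r, v} \<in> edges qs \<union> edges ps"
    moreover have "{r, v} \<notin> edges ps" using grows_new_edge[OF gs] by blast
    ultimately have "{r, v} \<in> edges qs" by simp
    then show False using g
    proof (induction qs)
      case (Cons a qs)
      obtain w x where a: "a = (w, x)" by (cases a)
      have "v \<in> verts r (qs @ (v, u) # ps)" by (simp add: verts_def)
      then have "{r, v} \<noteq> {w, x}" using Cons.prems a by auto
      then show ?case using Cons a by auto
    qed simp
  qed
  have lab': "relabel ?m (THE i. (f, i) \<in> D1) = lab ?ps' f" if f: "f \<in> edges ?ps'" for f
  proof -
    consider "f = {r, v}" | "f \<in> edges qs" "f \<noteq> {r, v}" | "f \<in> edges ps" "f \<noteq> {r, v}"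
      using f by auto
    then show ?thesis
    proof cases
      case 1
      then have "(THE i. (f, i) \<in> D1) = 0" using rv_new D1 by (intro the_equality) auto
      then show ?thesis using 1 rv_new by (simp add: lab_append relabel_simps)
    next
      case 2
      then have "(THE i. (f, i) \<in> D1) = L f" using D1 by (intro the_equality) auto
      then show ?thesis using 2 Lqs[of f] lab_bounds[of f qs] by (simp add: lab_append relabel_simps)
    next
      case 3
      then have "(THE i. (f, i) \<in> D1) = L f" using D1 by (intro the_equality) auto
      moreover have "f \<noteq> {v, u}" using 3 grows_new_edge[OF gs] by blast
      then have "L f = lab ps f" using Lps[of f] 3 by simp
      ultimately show ?thesis using 3 disj[of f] lab_bounds[of f ps]
        by (simp add: lab_append relabel_simps)
    qed
  qed
  have "(\<lambda>f\<in>edges ?ps'. relabel ?m (THE i. (f, i) \<in> D1)) = lab ?ps'"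
  proof
    fix f
    show "(\<lambda>f\<in>edges ?ps'. relabel ?m (THE i. (f, i) \<in> D1)) f = lab ?ps' f"
      using lab'[of f] lab_extensional[of ?ps']
      by (cases "f \<in> edges ?ps'") (simp_all add: extensional_def del: edges_simps)
  qed
  moreover have "verts r ?ps = verts v ?ps'" by (auto simp: verts_def)
  moreover have "close_cycle (((verts r ?ps, F), r), L) v =
      (((verts r ?ps, fst ` D1), v), \<lambda>f\<in>fst ` D1. relabel ?m (THE i. (f, i) \<in> D1))"
    unfolding close_cycle_def prod.case Let_def D_def[symmetric] the_C Max D1_def[symmetric]
    by (rule refl)
  ultimately show ?thesis
    unfolding F1 by (simp only: F_def L_def tree_of_def)
qed

definition move_to_front :: "'a \<Rightarrow> ('a \<times> 'a) list \<Rightarrow> 'a \<Rightarrow> ('a \<times> 'a) list" where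
  "move_to_front r ps v =
     (if v = r then ps
      else if v \<in> verts r ps then filter (\<lambda>a. fst a \<noteq> v) ps @ [(r, v)]
      else tl (ps @ [(r, v)]))"

lemma grows_split_at:
  assumes g: "grows V E r ps" and v: "v \<in> verts r ps" "v \<noteq> r"
  obtains qs u ps' where "ps = qs @ (v, u) # ps'"
    and "filter (\<lambda>a. fst a \<noteq> v) ps = qs @ ps'"
proof -
  obtain u where "(v, u) \<in> set ps" using v by (auto simp: verts_def)
  then obtain qs ps' where ps: "ps = qs @ (v, u) # ps'" by (auto simp: in_set_conv_decomp)
  have "distinct (map fst ps)" using grows_distinct[OF g] by simp
  then have "v \<notin> fst ` set qs" "v \<notin> fst ` set ps'" using ps by auto
  then have "filter (\<lambda>a. fst a \<noteq> v) qs = qs" "filter (\<lambda>a. fst a \<noteq> v) ps' = ps'"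
    by (auto simp: filter_id_conv)
  then show thesis using that[OF ps] ps by simp
qed

lemma grows_tl: "grows V E r ps \<Longrightarrow> grows V E r (tl ps)"
  by (cases ps) auto

lemma step_tree_of:
  assumes g: "grows V E r ps" and v: "v \<in> V" "{r, v} \<in> E"
  shows "step (tree_of r ps) v = tree_of v (move_to_front r ps v)"
    and "grows V E v (move_to_front r ps v)"
    and "length (move_to_front r ps v) = length ps"
proof -
  have "step (tree_of r ps) v = tree_of v (move_to_front r ps v) \<and>
    grows V E v (move_to_front r ps v) \<and> length (move_to_front r ps v) = length ps"
  proof (cases "v = r \<or> v \<notin> verts r ps")
    case True
    show ?thesis
    proof (cases "v = r")
      case True
      then show ?thesis using g by (simp add: step_def tree_of_def move_to_front_def)
    next
      case False
      with True have new: "v \<notin> verts r ps" by simp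
      have "step (tree_of r ps) v = extend_erase (tree_of r ps) v"
        using False new by (simp add: step_def tree_of_def)
      then show ?thesis
        using extend_erase_tree_of[OF g v(1) new v(2)] False new
          grows_tl[OF grows_new_root[OF g v(1) new v(2)]]
        by (simp add: move_to_front_def)
    qed
  next
    case False
    then have "v \<noteq> r" "v \<in> verts r ps" by auto
    then obtain qs u ps' where ps: "ps = qs @ (v, u) # ps'"
      and filter: "filter (\<lambda>a. fst a \<noteq> v) ps = qs @ ps'"
      using grows_split_at[OF g] by metis
    have "step (tree_of r ps) v = close_cycle (tree_of r ps) v"
      using False by (simp add: step_def tree_of_def)
    moreover have "move_to_front r ps v = qs @ ps' @ [(r, v)]"
      using False filter by (simp add: move_to_front_def)
    ultimately show ?thesis
      using close_cycle_tree_of[of V E r qs v u ps'] grows_reroot[of V E r qs v u ps'] g v ps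
      by simp
  qed
  then show "step (tree_of r ps) v = tree_of v (move_to_front r ps v)"
    and "grows V E v (move_to_front r ps v)"
    and "length (move_to_front r ps v) = length ps" by simp_all
qed

text \<open>The case to check is that \<open>v\<close> is itself the vertex attached last. Moving it to the front
  makes its predecessor the last one, which truncation then forgets. Truncating first puts
  \<open>v\<close> outside the tree, so that the move drops the same predecessor.\<close>

lemma tl_move_to_front:
  assumes g: "grows V E r (a # ps)"
  shows "tl (move_to_front r (a # ps) v) = move_to_front r ps v"
proof -
  obtain w u where a: "a = (w, u)" by (cases a)
  have w: "w \<notin> verts r ps" using g a by simp
  then have "filter (\<lambda>a. fst a \<noteq> w) ps = ps" by (auto simp: filter_id_conv verts_def)
  then show ?thesis using w a by (auto simp: move_to_front_def)
qed

section \<open>The invariant distribution and the reversed transition matrix\<close>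

text \<open>By elimination of states: watching the chain only outside a state \<open>z\<close> gives a transition
  matrix on fewer states, and an invariant measure for it extends to \<open>z\<close> by the balance
  equation at \<open>z\<close>. This fails only if \<open>z\<close> is absorbing, and then the point mass at \<open>z\<close> is invariant.\<close>

lemma invariant_measure_exists:
  fixes M :: "'a \<Rightarrow> 'a \<Rightarrow> real"
  assumes "finite V" "V \<noteq> {}"
    and "\<And>x y. x \<in> V \<Longrightarrow> y \<in> V \<Longrightarrow> 0 \<le> M x y" "\<And>x. x \<in> V \<Longrightarrow> (\<Sum>y\<in>V. M x y) = 1"
  shows "\<exists>\<rho>. (\<forall>x\<in>V. 0 \<le> \<rho> x) \<and> (\<exists>x\<in>V. \<rho> x > 0) \<and> (\<forall>y\<in>V. (\<Sum>x\<in>V. \<rho> x * M x y) = \<rho> y)"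
  using assms
proof (induction V arbitrary: M rule: finite_ne_induct)
  case (singleton z)
  then show ?case by (intro exI[of _ "\<lambda>_. 1"]) simp
next
  case (insert z V)
  have nn: "0 \<le> M x y" if "x \<in> insert z V" "y \<in> insert z V" for x y
    using insert.prems(1) that by blast
  have row: "M x z + (\<Sum>y\<in>V. M x y) = 1" if "x \<in> insert z V" for x
    using insert.prems(2)[OF that] insert.hyps by simp
  have le1: "0 \<le> (\<Sum>y\<in>V. M z y)" using nn by (intro sum_nonneg) auto
  show ?case
  proof (cases "M z z = 1")
    case True
    then have "(\<Sum>y\<in>V. M z y) = 0" using row[of z] by simp
    then have "M z y = 0" if "y \<in> V" for y
      using that nn insert.hyps(1) by (subst (asm) sum_nonneg_eq_0_iff) auto
    then have "(\<Sum>x\<in>insert z V. (if x = z then 1 else 0) * M x y) = (if y = z then 1 else 0)"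
      if "y \<in> insert z V" for y
      using that True insert.hyps by (auto simp: if_distrib[of "\<lambda>c. c * _"] cong: if_cong)
    then show ?thesis by (intro exI[of _ "\<lambda>x. if x = z then 1 else 0"]) auto
  next
    case False
    define d where "d = 1 - M z z"
    have d: "d > 0" using row[of z] le1 False by (simp add: d_def)
    have dsum: "(\<Sum>y\<in>V. M z y) = d" using row[of z] by (simp add: d_def)
    \<comment> \<open>Every excursion to \<open>z\<close>, which lasts a geometric time, is replaced by a direct jump.\<close>
    define M' where "M' x y = M x y + M x z * M z y / d" for x y
    have "(\<Sum>y\<in>V. M' x y) = 1" if "x \<in> V" for x
    proof -
      have "(\<Sum>y\<in>V. M' x y) = (\<Sum>y\<in>V. M x y) + M x z * (\<Sum>y\<in>V. M z y) / d"
        by (simp add: M'_def sum.distrib sum_distrib_left sum_divide_distrib)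
      then show ?thesis using row[of x] that d dsum by simp
    qed
    moreover have "0 \<le> M' x y" if "x \<in> V" "y \<in> V" for x y
      using that nn d by (simp add: M'_def)
    ultimately obtain \<rho> where \<rho>: "\<forall>x\<in>V. 0 \<le> \<rho> x" "\<exists>x\<in>V. \<rho> x > 0"
      and inv: "\<And>y. y \<in> V \<Longrightarrow> (\<Sum>x\<in>V. \<rho> x * M' x y) = \<rho> y"
      using insert.IH[of M'] by blast
    define s where "s = (\<Sum>x\<in>V. \<rho> x * M x z)"
    have "s \<ge> 0" unfolding s_def using \<rho> nn by (intro sum_nonneg mult_nonneg_nonneg) auto
    define \<sigma> where "\<sigma> = \<rho>(z := s / d)"
    have \<sigma>V: "(\<Sum>x\<in>V. \<sigma> x * M x y) = (\<Sum>x\<in>V. \<rho> x * M x y)" for y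
      using insert.hyps by (intro sum.cong) (auto simp: \<sigma>_def)
    have "(\<Sum>x\<in>insert z V. \<sigma> x * M x y) = \<sigma> y" if y: "y \<in> insert z V" for y
    proof (cases "y = z")
      case True
      have "s / d * M z z + s = s / d"
        using d by (simp add: d_def field_simps)
      then show ?thesis using insert.hyps True \<sigma>V[of z] by (simp add: \<sigma>_def s_def)
    next
      case False
      then have "y \<in> V" using y by simp
      have "\<rho> y = (\<Sum>x\<in>V. \<rho> x * M x y) + s / d * M z y"
      proof -
        have "s / d * M z y = (\<Sum>x\<in>V. \<rho> x * (M x z * M z y / d))"
          unfolding s_def sum_divide_distrib sum_distrib_right by (intro sum.cong) simp_all
        then show ?thesis
          unfolding inv[OF \<open>y \<in> V\<close>, symmetric] M'_def
          by (simp add: distrib_left sum.distrib)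
      qed
      then show ?thesis using insert.hyps False \<sigma>V[of y] by (simp add: \<sigma>_def)
    qed
    moreover have "\<forall>x\<in>insert z V. 0 \<le> \<sigma> x" using \<rho> \<open>s \<ge> 0\<close> d by (simp add: \<sigma>_def)
    moreover have "\<exists>x\<in>insert z V. \<sigma> x > 0" using \<rho>(2) insert.hyps by (auto simp: \<sigma>_def)
    ultimately show ?thesis by blast
  qed
qed

text \<open>Where the measure vanishes, no mass flows in, so it vanishes at all neighbours.\<close>

lemma invariant_measure_vanishes:
  assumes G: "finite_graph V E" "connected_graph V E"
    and M: "transition_matrix V M" "positive_on V E M"
    and \<rho>: "\<And>x. x \<in> V \<Longrightarrow> 0 \<le> \<rho> x" "\<And>y. y \<in> V \<Longrightarrow> (\<Sum>x\<in>V. \<rho> x * M x y) = \<rho> y"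
    and zero: "y \<in> V" "\<rho> y = 0" and "x \<in> V"
  shows "\<rho> x = 0"
proof -
  have "finite V" using G(1) by (simp add: finite_graph_def)
  have "(y, x) \<in> {(x, y). {x, y} \<in> E}\<^sup>*"
    using G(2) zero(1) \<open>x \<in> V\<close> by (simp add: connected_graph_def)
  then have "x \<in> V \<and> \<rho> x = 0"
  proof (induction rule: rtrancl_induct)
    case base
    then show ?case using zero by simp
  next
    case (step b c)
    then have e: "{c, b} \<in> E" by (simp add: insert_commute)
    then obtain p q where pq: "p \<in> V" "q \<in> V" "{c, b} = {p, q}"
      using G(1) unfolding finite_graph_def by meson
    have "{c, b} \<subseteq> V" unfolding pq(3) using pq(1,2) by simp
    then have "c \<in> V" by simp
    then have "M c b > 0" using M(2) e step.IH by (simp add: positive_on_def)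
    have "0 \<le> \<rho> a * M a b" if "a \<in> V" for a
      using \<rho>(1)[OF that] M(1) that step.IH by (simp add: transition_matrix_def)
    moreover have "(\<Sum>a\<in>V. \<rho> a * M a b) = 0" using \<rho>(2)[of b] step.IH by simp
    ultimately have "\<rho> c * M c b = 0"
      using \<open>finite V\<close> \<open>c \<in> V\<close> by (simp add: sum_nonneg_eq_0_iff)
    then show ?case using \<open>c \<in> V\<close> \<open>M c b > 0\<close> by simp
  qed
  then show ?thesis by simp
qed

lemma invariant_distribution_pos:
  assumes G: "finite_graph V E" "connected_graph V E"
    and M: "transition_matrix V M" "positive_on V E M"
    and \<rho>: "invariant_distribution V M \<rho>" and "x \<in> V"
  shows "\<rho> x > 0"
proof (rule ccontr)
  assume "\<not> \<rho> x > 0"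
  then have "\<rho> x = 0" using \<rho> \<open>x \<in> V\<close> by (force simp: invariant_distribution_def)
  then have "\<rho> y = 0" if "y \<in> V" for y
    using invariant_measure_vanishes[OF G M, of \<rho> x y] \<rho> that \<open>x \<in> V\<close>
    by (simp add: invariant_distribution_def)
  then have "(\<Sum>y\<in>V. \<rho> y) = 0" by simp
  then show False using \<rho> by (simp add: invariant_distribution_def)
qed

text \<open>Subtract from \<open>\<rho>\<close> the largest multiple of \<open>\<sigma>\<close> that leaves a nonnegative measure. The
  difference is invariant and vanishes at a point, hence everywhere.\<close>

lemma invariant_distribution_unique:
  assumes G: "finite_graph V E" "connected_graph V E"
    and M: "transition_matrix V M" "positive_on V E M"
    and \<rho>: "invariant_distribution V M \<rho>" and \<sigma>: "invariant_distribution V M \<sigma>"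
  shows "\<rho> = \<sigma>"
proof -
  have fin: "finite V" using G(1) by (simp add: finite_graph_def)
  have "V \<noteq> {}" using \<rho> by (auto simp: invariant_distribution_def)
  define c where "c = Min ((\<lambda>x. \<rho> x / \<sigma> x) ` V)"
  have "c \<in> (\<lambda>x. \<rho> x / \<sigma> x) ` V" unfolding c_def using fin \<open>V \<noteq> {}\<close> by (intro Min_in) auto
  then obtain x0 where x0: "x0 \<in> V" "c = \<rho> x0 / \<sigma> x0" by blast
  have pos: "\<sigma> x > 0" if "x \<in> V" for x
    using invariant_distribution_pos[OF G M \<sigma> that] .
  have le: "c * \<sigma> x \<le> \<rho> x" if "x \<in> V" for x
  proof -
    have "c \<le> \<rho> x / \<sigma> x" unfolding c_def using that fin by (intro Min_le) auto
    then show ?thesis using pos[OF that] by (simp add: le_divide_eq)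
  qed
  have eq: "\<rho> x = c * \<sigma> x" if "x \<in> V" for x
  proof -
    have "\<rho> x - c * \<sigma> x = 0"
    proof (rule invariant_measure_vanishes[OF G M _ _ x0(1) _ that, of "\<lambda>x. \<rho> x - c * \<sigma> x"])
      show "(\<Sum>x\<in>V. (\<rho> x - c * \<sigma> x) * M x y) = \<rho> y - c * \<sigma> y" if "y \<in> V" for y
      proof -
        have "(\<Sum>x\<in>V. (\<rho> x - c * \<sigma> x) * M x y)
            = (\<Sum>x\<in>V. \<rho> x * M x y) - c * (\<Sum>x\<in>V. \<sigma> x * M x y)"
          by (simp add: left_diff_distrib sum_subtractf sum_distrib_left mult.assoc)
        then show ?thesis using \<rho> \<sigma> that by (simp add: invariant_distribution_def)
      qed
      show "\<rho> x0 - c * \<sigma> x0 = 0" using x0 pos[OF x0(1)] by simp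
    qed (use le in simp)
    then show ?thesis by simp
  qed
  have "(\<Sum>x\<in>V. \<rho> x) = c * (\<Sum>x\<in>V. \<sigma> x)" using eq by (simp add: sum_distrib_left)
  then have "c = 1" using \<rho> \<sigma> by (simp add: invariant_distribution_def)
  show ?thesis
  proof
    fix x
    show "\<rho> x = \<sigma> x" using eq[of x] \<open>c = 1\<close> \<rho> \<sigma>
      by (cases "x \<in> V") (simp_all add: invariant_distribution_def)
  qed
qed

lemma stationary_invariant:
  assumes G: "finite_graph V E" "connected_graph V E" and "V \<noteq> {}"
    and M: "transition_matrix V M" "positive_on V E M"
  shows "invariant_distribution V M (stationary V M)"
proof -
  have fin: "finite V" using G(1) by (simp add: finite_graph_def)
  obtain \<rho> where \<rho>: "\<forall>x\<in>V. 0 \<le> \<rho> x" "\<exists>x\<in>V. \<rho> x > 0"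
    "\<And>y. y \<in> V \<Longrightarrow> (\<Sum>x\<in>V. \<rho> x * M x y) = \<rho> y"
    using invariant_measure_exists[OF fin \<open>V \<noteq> {}\<close>, of M] M(1)
    unfolding transition_matrix_def by blast
  define s where "s = (\<Sum>x\<in>V. \<rho> x)"
  obtain z where "z \<in> V" "\<rho> z > 0" using \<rho>(2) by blast
  then have "s > 0" unfolding s_def using \<rho>(1) fin by (intro sum_pos2[of V z]) auto
  have inv: "invariant_distribution V M (\<lambda>x. if x \<in> V then \<rho> x / s else 0)"
    unfolding invariant_distribution_def
  proof (intro conjI ballI)
    show "(\<Sum>x\<in>V. if x \<in> V then \<rho> x / s else 0) = 1"
      using \<open>s > 0\<close> by (simp add: s_def flip: sum_divide_distrib)
    show "(\<Sum>x\<in>V. (if x \<in> V then \<rho> x / s else 0) * M x y) = (if y \<in> V then \<rho> y / s else 0)"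
      if "y \<in> V" for y
      using \<rho>(3)[OF that] that by (simp flip: sum_divide_distrib)
  qed (use \<rho>(1) \<open>s > 0\<close> in auto)
  show ?thesis
    unfolding stationary_def
    by (rule theI[where P = "invariant_distribution V M", OF inv]) (rule invariant_distribution_unique[OF G M _ inv])
qed

lemma time_reversal_transition:
  assumes G: "finite_graph V E" "connected_graph V E"
    and M: "transition_matrix V M" "positive_on V E M"
  shows time_reversal_nonneg: "x \<in> V \<Longrightarrow> v \<in> V \<Longrightarrow> 0 \<le> time_reversal V M x v"
    and time_reversal_sum: "x \<in> V \<Longrightarrow> (\<Sum>v\<in>V. time_reversal V M x v) = 1"
    and time_reversal_non_edge: "x \<in> V \<Longrightarrow> v \<in> V \<Longrightarrow> {x, v} \<notin> E \<Longrightarrow> time_reversal V M x v = 0"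
proof -
  let ?\<rho> = "stationary V M"
  have inv: "invariant_distribution V M ?\<rho>" if "x \<in> V" for x
    using stationary_invariant[OF G _ M] that by auto
  have pos: "?\<rho> x > 0" if "x \<in> V" for x
    using invariant_distribution_pos[OF G M inv[OF that] that] .
  show "0 \<le> time_reversal V M x v" if "x \<in> V" "v \<in> V"
    using pos that M(1) by (simp add: time_reversal_def transition_matrix_def less_imp_le)
  show "(\<Sum>v\<in>V. time_reversal V M x v) = 1" if "x \<in> V"
    using inv[OF that] pos[OF that] that
    by (simp add: time_reversal_def invariant_distribution_def flip: sum_divide_distrib)
  show "time_reversal V M x v = 0" if "x \<in> V" "v \<in> V" "{x, v} \<notin> E"
  proof -
    have "\<not> M v x > 0" "0 \<le> M v x"
      using M that by (auto simp: positive_on_def transition_matrix_def insert_commute)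
    then show ?thesis by (simp add: time_reversal_def)
  qed
qed

section \<open>Functions of a Markov chain\<close>

text \<open>An event about the past of the image chain is the disjoint union of the pasts of the
  original chain that lie above it. On each of these the image of the next state has the
  same conditional law, so this is also its law given their union.\<close>

lemma lumped_markov_chain:
  assumes X: "markov_chain P S K X" and fin: "finite S" and f: "f \<in> S \<rightarrow> S'"
    and lump: "\<And>x y'. x \<in> S \<Longrightarrow> y' \<in> S' \<Longrightarrow> (\<Sum>y\<in>{y \<in> S. f y = y'}. K x y) = K' (f x) y'"
  shows "markov_chain P S' K' (\<lambda>j \<omega>. f (X j \<omega>))"
  unfolding markov_chain_def
proof (intro conjI allI impI)
  show "prob_space P" using X by (simp add: markov_chain_def)
  then interpret prob_space P .
  have meas: "X j \<in> measurable P (count_space S)" for j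
    using X by (simp add: markov_chain_def)
  then have XS: "X j \<omega> \<in> S" if "\<omega> \<in> space P" for j \<omega>
    using measurable_space[OF meas that] by simp
  show "(\<lambda>\<omega>. f (X j \<omega>)) \<in> measurable P (count_space S')" for j
    using f by (intro measurable_compose[OF meas]) auto
  fix j x
  assume x: "\<forall>i\<le>Suc j. x i \<in> S'"
    and pos: "\<P>(\<omega> in P. \<forall>i\<le>j. f (X i \<omega>) = x i) > 0"
  define past where "past z = {\<omega> \<in> space P. \<forall>i\<le>j. X i \<omega> = z i}" for z
  define future where "future y = {\<omega> \<in> space P. X (Suc j) \<omega> = y}" for y
  define Z where "Z = {z \<in> PiE {..j} (\<lambda>_. S). \<forall>i\<le>j. f (z i) = x i}"
  define T where "T = {y \<in> S. f y = x (Suc j)}"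
  have finZ: "finite Z"
    by (rule finite_subset[OF _ finite_PiE[of "{..j}" "\<lambda>_. S"]]) (auto simp: Z_def fin)
  have finT: "finite T" unfolding T_def using fin by simp
  have ev: "{\<omega> \<in> space P. X i \<omega> = s} \<in> events" if "s \<in> S" for i s
  proof -
    have "{\<omega> \<in> space P. X i \<omega> = s} = X i -` {s} \<inter> space P" by auto
    then show ?thesis using measurable_sets[OF meas, of "{s}" i] that by (simp only: sets_count_space) simp
  qed
  have past_ev: "past z \<in> events" if "z \<in> Z" for z
  proof -
    have "{\<omega> \<in> space P. \<forall>i\<in>{..j}. X i \<omega> = z i} \<in> events"
      using that by (intro sets.sets_Collect_finite_All ev) (auto simp: Z_def)
    moreover have "past z = {\<omega> \<in> space P. \<forall>i\<in>{..j}. X i \<omega> = z i}" by (auto simp: past_def)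
    ultimately show ?thesis by (simp only:)
  qed
  have next_ev: "future y \<in> events" if "y \<in> T" for y
  proof -
    have "y \<in> S" using that by (simp add: T_def)
    then show ?thesis unfolding future_def by (rule ev)
  qed
  have past_disj: "z = z'" if "z \<in> Z" "z' \<in> Z" "\<omega> \<in> past z" "\<omega> \<in> past z'" for z z' \<omega>
  proof (rule PiE_ext[of z "{..j}" "\<lambda>_. S" z'])
    show "z \<in> PiE {..j} (\<lambda>_. S)" "z' \<in> PiE {..j} (\<lambda>_. S)" using that by (auto simp: Z_def)
    show "z i = z' i" if "i \<in> {..j}" for i
      using \<open>\<omega> \<in> past z\<close> \<open>\<omega> \<in> past z'\<close> that by (auto simp: past_def)
  qed
  have in_past: "\<exists>z\<in>Z. \<omega> \<in> past z" if "\<omega> \<in> space P" "\<forall>i\<le>j. f (X i \<omega>) = x i" for \<omega>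
    using that XS by (intro bexI[of _ "\<lambda>i\<in>{..j}. X i \<omega>"]) (auto simp: past_def Z_def)
  have past_event: "{\<omega> \<in> space P. \<forall>i\<le>j. f (X i \<omega>) = x i} = (\<Union>z\<in>Z. past z)"
  proof (intro set_eqI iffI)
    fix \<omega> assume "\<omega> \<in> {\<omega> \<in> space P. \<forall>i\<le>j. f (X i \<omega>) = x i}"
    then show "\<omega> \<in> (\<Union>z\<in>Z. past z)" using in_past[of \<omega>] by auto
  qed (auto simp: past_def Z_def)
  have prob_past: "\<P>(\<omega> in P. \<forall>i\<le>j. f (X i \<omega>) = x i) = (\<Sum>z\<in>Z. prob (past z))"
    unfolding past_event
    using past_disj finZ past_ev
    by (intro finite_measure_finite_Union) (auto simp: disjoint_family_on_def)
  have next_event: "{\<omega> \<in> space P. f (X (Suc j) \<omega>) = x (Suc j) \<and> (\<forall>i\<le>j. f (X i \<omega>) = x i)}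
      = (\<Union>(z, y)\<in>Z \<times> T. past z \<inter> future y)"
  proof (intro set_eqI iffI)
    fix \<omega> assume "\<omega> \<in> {\<omega> \<in> space P. f (X (Suc j) \<omega>) = x (Suc j) \<and> (\<forall>i\<le>j. f (X i \<omega>) = x i)}"
    then show "\<omega> \<in> (\<Union>(z, y)\<in>Z \<times> T. past z \<inter> future y)"
      using in_past[of \<omega>] XS by (auto simp: future_def T_def)
  qed (auto simp: past_def future_def Z_def T_def)
  \<comment> \<open>For a past of probability 0 both sides vanish; the Markov property speaks of the others.\<close>
  have step: "prob (past z \<inter> future y) = prob (past z) * K (z j) y" if z: "z \<in> Z" and y: "y \<in> T" for z y
  proof (cases "prob (past z) > 0")
    case True
    let ?z = "z(Suc j := y)"
    have markov: "\<P>(\<omega> in P. X (Suc j) \<omega> = w (Suc j) \<bar> \<forall>i\<le>j. X i \<omega> = w i) = K (w j) (w (Suc j))"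
      if "\<forall>i\<le>Suc j. w i \<in> S" "\<P>(\<omega> in P. \<forall>i\<le>j. X i \<omega> = w i) > 0" for w
      using X that unfolding markov_chain_def by presburger
    have past: "{\<omega> \<in> space P. \<forall>i\<le>j. X i \<omega> = ?z i} = past z" by (auto simp: past_def)
    have both: "{\<omega> \<in> space P. X (Suc j) \<omega> = ?z (Suc j) \<and> (\<forall>i\<le>j. X i \<omega> = ?z i)} = past z \<inter> future y"
      by (auto simp: past_def future_def)
    have "\<forall>i\<le>Suc j. ?z i \<in> S" using z y by (auto simp: Z_def T_def le_Suc_eq)
    from markov[OF this, unfolded cond_prob_def past both, OF True]
    have "prob (past z \<inter> future y) / prob (past z) = K (z j) y" by simp
    then show ?thesis using True by (simp add: field_simps)
  next
    case False
    then have "prob (past z) = 0" using measure_nonneg[of P "past z"] by linarith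
    moreover have "prob (past z \<inter> future y) \<le> prob (past z)"
      using past_ev[OF z] by (intro finite_measure_mono) auto
    ultimately show ?thesis using measure_nonneg[of P "past z \<inter> future y"] by simp
  qed
  have "prob (\<Union>(z, y)\<in>Z \<times> T. past z \<inter> future y) = (\<Sum>(z, y)\<in>Z \<times> T. prob (past z \<inter> future y))"
  proof -
    have "prob (\<Union>p\<in>Z \<times> T. past (fst p) \<inter> future (snd p))
        = (\<Sum>p\<in>Z \<times> T. prob (past (fst p) \<inter> future (snd p)))"
    proof (rule finite_measure_finite_Union)
      show "disjoint_family_on (\<lambda>p. past (fst p) \<inter> future (snd p)) (Z \<times> T)"
        unfolding disjoint_family_on_def
      proof (intro ballI impI)
        fix p q assume pq: "p \<in> Z \<times> T" "q \<in> Z \<times> T" "p \<noteq> q"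
        show "(past (fst p) \<inter> future (snd p)) \<inter> (past (fst q) \<inter> future (snd q)) = {}"
        proof (rule ccontr)
          assume "\<not> ?thesis"
          then obtain \<omega> where "\<omega> \<in> past (fst p)" "\<omega> \<in> past (fst q)"
            "\<omega> \<in> future (snd p)" "\<omega> \<in> future (snd q)" by blast
          then have "fst p = fst q" "snd p = snd q"
            using past_disj[of "fst p" "fst q" \<omega>] pq by (auto simp: future_def)
          then show False using pq(3) by (simp add: prod_eq_iff)
        qed
      qed
      show "(\<lambda>p. past (fst p) \<inter> future (snd p)) ` (Z \<times> T) \<subseteq> events"
        using past_ev next_ev by (intro image_subsetI sets.Int) auto
    qed (use finZ finT in simp)
    then show ?thesis by (simp add: case_prod_beta)
  qed
  also have "\<dots> = (\<Sum>z\<in>Z. \<Sum>y\<in>T. prob (past z \<inter> future y))"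
    by (rule sum.cartesian_product[symmetric])
  also have "\<dots> = (\<Sum>z\<in>Z. prob (past z) * K' (x j) (x (Suc j)))"
  proof (rule sum.cong[OF refl])
    fix z assume z: "z \<in> Z"
    then have zj: "z j \<in> S" "f (z j) = x j" by (auto simp: Z_def)
    have "(\<Sum>y\<in>T. prob (past z \<inter> future y)) = prob (past z) * (\<Sum>y\<in>T. K (z j) y)"
      using step[OF z] by (simp add: sum_distrib_left)
    also have "(\<Sum>y\<in>T. K (z j) y) = K' (x j) (x (Suc j))"
      using lump[OF zj(1), of "x (Suc j)"] x zj(2) by (simp add: T_def)
    finally show "(\<Sum>y\<in>T. prob (past z \<inter> future y)) = prob (past z) * K' (x j) (x (Suc j))" .
  qed
  also have "\<dots> = (\<Sum>z\<in>Z. prob (past z)) * K' (x j) (x (Suc j))"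
    by (simp add: sum_distrib_right)
  finally show "\<P>(\<omega> in P. f (X (Suc j) \<omega>) = x (Suc j) \<bar> \<forall>i\<le>j. f (X i \<omega>) = x i) = K' (x j) (x (Suc j))"
    using pos unfolding cond_prob_def next_event prob_past by simp
qed

section \<open>The kernel on labelled trees\<close>

lemma root_of_tree_of [simp]: "root_of (tree_of r ps) = r"
  by (simp add: tree_of_def)

lemma labelled_trees_eq:
  assumes G: "finite_graph V E" and n: "1 \<le> n"
  shows "labelled_trees V E n = {tree_of r ps |r ps. grows V E r ps \<and> Suc (length ps) = n}"
proof (intro set_eqI iffI)
  fix x assume "x \<in> labelled_trees V E n"
  then obtain W F r L where x: "x = (((W, F), r), L)" "(((W, F), r), L) \<in> labelled_trees_at V E n r"
    unfolding labelled_trees_def labelled_trees_at_def by auto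
  obtain ps where "grows V E r ps" "length ps = n - 1" "(((W, F), r), L) = tree_of r ps"
    using labelled_tree_imp_tree_of[OF G, of W F r L "n - 1"] n x(2) by auto
  moreover from this(2) n have "Suc (length ps) = n" by simp
  ultimately show "x \<in> {tree_of r ps |r ps. grows V E r ps \<and> Suc (length ps) = n}"
    unfolding x(1) by blast
next
  fix x assume "x \<in> {tree_of r ps |r ps. grows V E r ps \<and> Suc (length ps) = n}"
  then obtain r ps where x: "x = tree_of r ps" "grows V E r ps" "Suc (length ps) = n" by blast
  then have "r \<in> V" using grows_verts[of V E r ps] by (auto simp: verts_def)
  then show "x \<in> labelled_trees V E n"
    using tree_of_in_labelled_trees_at[OF x(2)] x unfolding labelled_trees_def by auto
qed

lemma labelled_tree_obtain:
  assumes "finite_graph V E" "1 \<le> n" "x \<in> labelled_trees V E n"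
  obtains r ps where "x = tree_of r ps" "grows V E r ps" "Suc (length ps) = n" "r \<in> V"
proof -
  obtain r ps where x: "x = tree_of r ps" "grows V E r ps" "Suc (length ps) = n"
    using assms labelled_trees_eq[of V E n] by auto
  moreover have "r \<in> V" using grows_verts[OF x(2)] by (auto simp: verts_def)
  ultimately show thesis using that by blast
qed

lemma finite_labelled_trees:
  assumes G: "finite_graph V E" and n: "1 \<le> n"
  shows "finite (labelled_trees V E n)"
proof -
  have fin: "finite V" using G by (simp add: finite_graph_def)
  let ?lists = "{ps. set ps \<subseteq> V \<times> V \<and> length ps = n - 1}"
  have pairs: "set ps \<subseteq> V \<times> V" if "grows V E r ps" for r ps
    using that
  proof (induction V E r ps rule: grows.induct)
    case (2 V E r w u ps)
    then show ?case using grows_verts[of V E r ps] by auto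
  qed simp
  have "labelled_trees V E n \<subseteq> case_prod tree_of ` (V \<times> ?lists)"
  proof
    fix x assume "x \<in> labelled_trees V E n"
    from labelled_tree_obtain[OF G n this] obtain r ps
      where x: "x = tree_of r ps" "grows V E r ps" "Suc (length ps) = n" "r \<in> V" .
    then have "(r, ps) \<in> V \<times> ?lists" using pairs[OF x(2)] by auto
    then show "x \<in> case_prod tree_of ` (V \<times> ?lists)" using x(1) by (intro rev_image_eqI) auto
  qed
  moreover have "finite (case_prod tree_of ` (V \<times> ?lists))"
    using fin by (intro finite_imageI finite_cartesian_product finite_lists_length_eq) auto
  ultimately show ?thesis by (rule finite_subset)
qed

lemma step_in_labelled_trees:
  assumes G: "finite_graph V E" and n: "1 \<le> n" and x: "x \<in> labelled_trees V E n"
    and v: "v \<in> V" "{root_of x, v} \<in> E"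
  shows "step x v \<in> labelled_trees V E n"
proof -
  obtain r ps where ps: "x = tree_of r ps" "grows V E r ps" "Suc (length ps) = n"
    using labelled_tree_obtain[OF G n x] by metis
  have e: "{r, v} \<in> E" using v(2) ps(1) by simp
  show ?thesis unfolding labelled_trees_eq[OF G n] using step_tree_of[OF ps(2) v(1) e] ps by auto
qed

lemma remove_max_in_labelled_trees:
  assumes G: "finite_graph V E" and n: "2 \<le> n" and x: "x \<in> labelled_trees V E n"
  shows "remove_max x \<in> labelled_trees V E (n - 1)" and "root_of (remove_max x) = root_of x"
proof -
  obtain r ps where ps: "x = tree_of r ps" "grows V E r ps" "Suc (length ps) = n"
    using labelled_tree_obtain[OF G _ x] n by (metis one_le_numeral order_trans)
  then obtain a qs where a: "ps = a # qs" using n by (cases ps) auto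
  have rm: "remove_max x = tree_of r qs" using remove_max_tree_of[of V E r a qs] ps a by simp
  have "grows V E r qs" using grows_tl[OF ps(2)] a by simp
  moreover have "Suc (length qs) = n - 1" using ps a by simp
  ultimately show "remove_max x \<in> labelled_trees V E (n - 1)"
    using labelled_trees_eq[OF G, of "n - 1"] n rm by auto
  show "root_of (remove_max x) = root_of x" using rm ps by simp
qed

lemma remove_max_step:
  assumes G: "finite_graph V E" and n: "2 \<le> n" and x: "x \<in> labelled_trees V E n"
    and v: "v \<in> V" "{root_of x, v} \<in> E"
  shows "remove_max (step x v) = step (remove_max x) v"
proof -
  obtain r ps where ps: "x = tree_of r ps" "grows V E r ps" "Suc (length ps) = n"
    using labelled_tree_obtain[OF G _ x] n by (metis one_le_numeral order_trans)
  then obtain a qs where a: "ps = a # qs" using n by (cases ps) auto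
  have e: "{r, v} \<in> E" using v(2) ps(1) by simp
  note st = step_tree_of[OF ps(2) v(1) e]
  obtain b rs where b: "move_to_front r ps v = b # rs"
    using st(3) a by (cases "move_to_front r ps v") auto
  have gq: "grows V E r qs" using grows_tl[OF ps(2)] a by simp
  have "remove_max (step x v) = tree_of v rs"
    using remove_max_tree_of[of V E v b rs] st b ps(1) by simp
  also have "rs = move_to_front r qs v"
    using tl_move_to_front[of V E r a qs v] ps(2) a b by simp
  also have "tree_of v \<dots> = step (tree_of r qs) v" using step_tree_of(1)[OF gq v(1) e] by simp
  also have "tree_of r qs = remove_max x"
    using remove_max_tree_of[of V E r a qs] ps a by simp
  finally show ?thesis .
qed

text \<open>Summing over target trees amounts to summing over the choices of the next root that lead
  there.\<close>

lemma sum_tree_kernel: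
  assumes "finite V" "finite T"
  shows "(\<Sum>y\<in>T. tree_kernel V M x y) =
    (\<Sum>v\<in>V. if step x v \<in> T then time_reversal V M (root_of x) v else 0)"
proof -
  let ?h = "time_reversal V M (root_of x)" and ?A = "{v \<in> V. step x v \<in> T}"
  have "(\<Sum>y\<in>T. tree_kernel V M x y) = (\<Sum>y\<in>T. \<Sum>v\<in>{v \<in> ?A. step x v = y}. ?h v)"
    unfolding tree_kernel_def by (intro sum.cong) auto
  also have "\<dots> = (\<Sum>v\<in>?A. ?h v)"
    using assms by (intro sum.group) auto
  also have "\<dots> = (\<Sum>v\<in>V. if step x v \<in> T then ?h v else 0)"
    using assms by (intro sum.inter_filter) auto
  finally show ?thesis .
qed

lemma root_of_labelled_tree:
  assumes "finite_graph V E" "1 \<le> n" "x \<in> labelled_trees V E n"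
  shows "root_of x \<in> V"
  using labelled_tree_obtain[OF assms] by (metis root_of_tree_of)

lemma labels_of_labelled_tree:
  assumes G: "finite_graph V E" and x: "(((W, F), r), L) \<in> labelled_trees V E n"
  shows "inj_on L F" and "inj_path W F p \<Longrightarrow> last p = r \<Longrightarrow> decreasing_along L p"
proof -
  have at: "(((W, F), r), L) \<in> labelled_trees_at V E n r"
    using x by (auto simp: labelled_trees_def labelled_trees_at_def)
  then show "inj_on L F" by (simp add: labelled_trees_at_def bij_betw_def)
  show "inj_path W F p \<Longrightarrow> last p = r \<Longrightarrow> decreasing_along L p"
    by (rule root_paths_decreasing[OF G at])
qed

lemma tree_kernel_transition_matrix:
  assumes G: "finite_graph V E" "connected_graph V E"
    and M: "transition_matrix V M" "positive_on V E M" and n: "1 \<le> n"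
  shows "transition_matrix (labelled_trees V E n) (tree_kernel V M)"
  unfolding transition_matrix_def
proof (intro conjI ballI)
  have finV: "finite V" using G(1) by (simp add: finite_graph_def)
  note tr = time_reversal_nonneg[OF G M] time_reversal_sum[OF G M] time_reversal_non_edge[OF G M]
  fix x assume x: "x \<in> labelled_trees V E n"
  note r = root_of_labelled_tree[OF G(1) n x]
  show "0 \<le> tree_kernel V M x y" for y
    unfolding tree_kernel_def using tr(1)[OF r] by (intro sum_nonneg) auto
  have "(\<Sum>y\<in>labelled_trees V E n. tree_kernel V M x y)
      = (\<Sum>v\<in>V. time_reversal V M (root_of x) v)"
    unfolding sum_tree_kernel[OF finV finite_labelled_trees[OF G(1) n]]
  proof (intro sum.cong refl)
    fix v assume "v \<in> V"
    then show "(if step x v \<in> labelled_trees V E n then time_reversal V M (root_of x) v else 0)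
        = time_reversal V M (root_of x) v"
      using tr(3)[OF r] step_in_labelled_trees[OF G(1) n x] by auto
  qed
  then show "(\<Sum>y\<in>labelled_trees V E n. tree_kernel V M x y) = 1"
    using tr(2)[OF r] by simp
qed

text \<open>For each neighbour \<open>v\<close> of the root, the step to \<open>v\<close> commutes with \<^const>\<open>remove_max\<close>; the
  other vertices have weight 0 on both sides.\<close>

lemma tree_kernel_lumps:
  assumes G: "finite_graph V E" "connected_graph V E"
    and M: "transition_matrix V M" "positive_on V E M"
    and n: "2 \<le> n" and x: "x \<in> labelled_trees V E n"
  shows "(\<Sum>y\<in>{y \<in> labelled_trees V E n. remove_max y = y'}. tree_kernel V M x y) =
    tree_kernel V M (remove_max x) y'"
proof -
  have n1: "1 \<le> n" using n by simp
  have finV: "finite V" using G(1) by (simp add: finite_graph_def)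
  let ?T = "{y \<in> labelled_trees V E n. remove_max y = y'}" and ?h = "time_reversal V M (root_of x)"
  have "finite ?T" using finite_labelled_trees[OF G(1) n1] by simp
  then have "(\<Sum>y\<in>?T. tree_kernel V M x y) = (\<Sum>v\<in>V. if step x v \<in> ?T then ?h v else 0)"
    by (rule sum_tree_kernel[OF finV])
  also have "\<dots> = (\<Sum>v\<in>V. if step (remove_max x) v \<in> {y'} then ?h v else 0)"
  proof (intro sum.cong refl)
    fix v assume v: "v \<in> V"
    show "(if step x v \<in> ?T then ?h v else 0) = (if step (remove_max x) v \<in> {y'} then ?h v else 0)"
    proof (cases "{root_of x, v} \<in> E")
      case True
      then show ?thesis
        using step_in_labelled_trees[OF G(1) n1 x v] remove_max_step[OF G(1) n x v] by simp
    next
      case False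
      then show ?thesis
        using time_reversal_non_edge[OF G M root_of_labelled_tree[OF G(1) n1 x] v] by simp
    qed
  qed
  also have "\<dots> = tree_kernel V M (remove_max x) y'"
    using sum_tree_kernel[OF finV, of "{y'}" M "remove_max x"]
    unfolding remove_max_in_labelled_trees(2)[OF G(1) n x] by simp
  finally show ?thesis .
qed

lemma remove_max_markov_chain:
  assumes G: "finite_graph V E" "connected_graph V E"
    and M: "transition_matrix V M" "positive_on V E M"
    and n: "2 \<le> n" and X: "markov_chain P (labelled_trees V E n) (tree_kernel V M) X"
  shows "markov_chain P (labelled_trees V E (n - 1)) (tree_kernel V M) (\<lambda>j \<omega>. remove_max (X j \<omega>))"
proof -
  have "finite (labelled_trees V E n)" using finite_labelled_trees[OF G(1)] n by simp
  moreover have "remove_max \<in> labelled_trees V E n \<rightarrow> labelled_trees V E (n - 1)"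
    using remove_max_in_labelled_trees(1)[OF G(1) n] by (rule Pi_I)
  ultimately show ?thesis
    using tree_kernel_lumps[OF G M n] by (rule lumped_markov_chain[OF X])
qed

theorem proposition23:
  fixes V :: "'a set" and E :: "'a set set" and M :: "'a \<Rightarrow> 'a \<Rightarrow> real"
  assumes "finite_graph V E" and "connected_graph V E" and "card V \<ge> 2"
    and "transition_matrix V M" and "positive_on V E M"
  shows "(\<forall>n. 1 \<le> n \<and> n \<le> card V \<longrightarrow>
            (\<forall>x\<in>labelled_trees V E n. \<forall>v\<in>V. time_reversal V M (root_of x) v > 0 \<longrightarrow>
               step x v \<in> labelled_trees V E n \<and>
               (\<forall>W1 F1 R1 L1. step x v = (((W1, F1), R1), L1) \<longrightarrow>
                  inj_on L1 F1 \<and>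
                  (\<forall>p. inj_path W1 F1 p \<and> last p = R1 \<longrightarrow> decreasing_along L1 p))) \<and>
            transition_matrix (labelled_trees V E n) (tree_kernel V M)) \<and>
         (\<forall>n (P :: 'w measure) X. 2 \<le> n \<and> n \<le> card V \<and>
            markov_chain P (labelled_trees V E n) (tree_kernel V M) X \<longrightarrow>
            markov_chain P (labelled_trees V E (n - 1)) (tree_kernel V M)
              (\<lambda>j \<omega>. remove_max (X j \<omega>)))"
proof (rule conjI)
  note G = assms(1)
  show "\<forall>n. 1 \<le> n \<and> n \<le> card V \<longrightarrow>
            (\<forall>x\<in>labelled_trees V E n. \<forall>v\<in>V. time_reversal V M (root_of x) v > 0 \<longrightarrow>
               step x v \<in> labelled_trees V E n \<and>
               (\<forall>W1 F1 R1 L1. step x v = (((W1, F1), R1), L1) \<longrightarrow>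
                  inj_on L1 F1 \<and>
                  (\<forall>p. inj_path W1 F1 p \<and> last p = R1 \<longrightarrow> decreasing_along L1 p))) \<and>
            transition_matrix (labelled_trees V E n) (tree_kernel V M)"
  proof (rule allI, rule impI, rule conjI)
    fix n assume "1 \<le> n \<and> n \<le> card V"
    then have n: "1 \<le> n" by (rule conjunct1)
    show "transition_matrix (labelled_trees V E n) (tree_kernel V M)"
      by (rule tree_kernel_transition_matrix[OF assms(1,2,4,5) n])
    show "\<forall>x\<in>labelled_trees V E n. \<forall>v\<in>V. time_reversal V M (root_of x) v > 0 \<longrightarrow>
        step x v \<in> labelled_trees V E n \<and>
        (\<forall>W1 F1 R1 L1. step x v = (((W1, F1), R1), L1) \<longrightarrow>
           inj_on L1 F1 \<and> (\<forall>p. inj_path W1 F1 p \<and> last p = R1 \<longrightarrow> decreasing_along L1 p))"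
    proof (intro ballI impI)
      fix x v assume x: "x \<in> labelled_trees V E n" and v: "v \<in> V"
        and pos: "time_reversal V M (root_of x) v > 0"
      have e: "{root_of x, v} \<in> E"
      proof (rule ccontr)
        assume "{root_of x, v} \<notin> E"
        from time_reversal_non_edge[OF assms(1,2,4,5) root_of_labelled_tree[OF G n x] v this] pos
        show False by simp
      qed
      have S: "step x v \<in> labelled_trees V E n" by (rule step_in_labelled_trees[OF G n x v e])
      moreover have "inj_on L1 F1 \<and> (\<forall>p. inj_path W1 F1 p \<and> last p = R1 \<longrightarrow> decreasing_along L1 p)"
        if "step x v = (((W1, F1), R1), L1)" for W1 F1 R1 L1
        using labels_of_labelled_tree[OF G S[unfolded that]] by simp
      ultimately show "step x v \<in> labelled_trees V E n \<and>
        (\<forall>W1 F1 R1 L1. step x v = (((W1, F1), R1), L1) \<longrightarrow>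
           inj_on L1 F1 \<and> (\<forall>p. inj_path W1 F1 p \<and> last p = R1 \<longrightarrow> decreasing_along L1 p))"
        by simp
    qed
  qed
  show "\<forall>n (P :: 'w measure) X. 2 \<le> n \<and> n \<le> card V \<and>
            markov_chain P (labelled_trees V E n) (tree_kernel V M) X \<longrightarrow>
            markov_chain P (labelled_trees V E (n - 1)) (tree_kernel V M)
              (\<lambda>j \<omega>. remove_max (X j \<omega>))"
    by (intro allI impI, elim conjE) (rule remove_max_markov_chain[OF assms(1,2,4,5)])
qed

end
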